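(* Let $M\ge2$ be an integer, let $(a_k)_{k\ge1}$ be an admissible sequence of parameters in $(0,\frac1{2M})$ with $\underline a=\inf_{k\geq 1} a_k$, $\overline a=\sup_{k\geq 1} a_k$, and let $\mu$ be a Borel probability measure on $X=[0,1]^2$ whose density $\rho=d\mu/dm$ with respect to Lebesgue measure $m$ is Lipschitz continuous with $\underline\rho=\inf_{x\in X}\rho(x)>0$. Let $\theta\in(0,1]$. There exist constants $C,C'>0$ depending only on $\theta,\underline\rho,|\rho|_{\mathrm{Lip}}$ and $M,\overline a,\underline a$ such that for any integer $n\ge2$, any separately $\theta$-Hölder continuous function $F\colon X^n\to\mathbb R$, any integer $1\le l<n$ and any sequence $0\le i_1<\cdots<i_n$ of integers, $$\left|\int_X H(x,x)\,d\mu(x)-\iint_{X^2}H(x,y)\,d\mu(x)\,d\mu(y)\right|\le C\|F\|_\theta\,(i_l+1)\,e^{-C'\sqrt{i_{l+1}-i_l}},$$ where $H\colon X^2\to\mathbb R$ is given by $$H(x,y)=F\bigl(T_{1,i_1}(x),\dots,T_{1,i_l}(x),T_{1,i_{l+1}}(y),\dots,T_{1,i_n}(y)\bigr).$$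
   Context: Heterochaos baker map. Let $X=[0,1]^2$ with coordinates $(x_u,x_c)$ and let $m$ be the Lebesgue measure on $X$. For $a\in(0,\frac1M)$ define $\tau_a\colon[0,1]\to[0,1]$ by $\tau_a(x_u)=\frac{x_u-(i-1)a}{a}$ on $[(i-1)a,ia)$, $i=1,\dots,M$, and $\tau_a(x_u)=\frac{x_u-Ma}{1-Ma}$ on $[Ma,1]$. Put $\Omega_a(\alpha_i)=[(i-1)a,ia)\times[0,1]$ for $i=1,\dots,M$, $\Omega_a(\beta_i)=[Ma,1]\times[\frac{i-1}M,\frac iM)$ for $i=1,\dots,M-1$, and $\Omega_a(\beta_M)=[Ma,1]\times[\frac{M-1}M,1]$. Define $f_a\colon X\to X$ by $f_a(x_u,x_c)=(\tau_a(x_u),\frac{x_c}M+\frac{i-1}M)$ on $\Omega_a(\alpha_i)$ and $f_a(x_u,x_c)=(\tau_a(x_u),Mx_c-i+1)$ on $\Omega_a(\beta_i)$, $i=1,\dots,M$. Write $T_k=f_{a_k}$, $T_{k,\ell}=T_\ell\circ\cdots\circ T_k$ for $k\le\ell$, and $T_{1,0}=\mathrm{id}_X$. Admissibility: $(a_k)_{k\ge1}$ is admissible if $\max\{0,\frac{4M\overline a-1}{4M^2\overline a}\}<\underline a\le\overline a<\frac1{2M}$. $|\rho|_{\mathrm{Lip}}$ is the Lipschitz seminorm of $\rho$ (Euclidean distance). For $F\colon X^n\to\mathbb R$ define $|F|_\theta=\max_{1\le i\le n}\sup_{x\in X^n}\sup_{t\ne t'\in X}\frac{|F(x(t/i))-F(x(t'/i))|}{|t-t'|^\theta}$,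 where $x(t/i)\in X^n$ is obtained from $x$ by replacing its $i$th component by $t$. $F$ is separately $\theta$-Hölder continuous if $|F|_\theta<\infty$, and then $\|F\|_\theta=\|F\|_\infty+|F|_\theta$, with $\|\cdot\|_\infty$ the supremum norm. *)

theory Defs
  imports "HOL-Probability.Probability"
begin

(* The metric of the type real * real is the Euclidean one. *)
definition square :: "(real \<times> real) set" where
  "square = {0..1} \<times> {0..1}"

definition leb_square :: "(real \<times> real) measure" where
  "leb_square = restrict_space lborel square"


definition Omega_alpha :: "real \<Rightarrow> nat \<Rightarrow> (real \<times> real) set" where
  "Omega_alpha a i = {(real i - 1) * a ..< real i * a} \<times> {0..1}"

definition Omega_beta :: "nat \<Rightarrow> real \<Rightarrow> nat \<Rightarrow> (real \<times> real) set" where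
  "Omega_beta M a i = {real M * a .. 1} \<times>
     (if i = M then {(real M - 1) / real M .. 1}
      else {(real i - 1) / real M ..< real i / real M})"

definition tau :: "nat \<Rightarrow> real \<Rightarrow> real \<Rightarrow> real" where
  "tau M a u =
     (if u < real M * a
      then let i = (THE i. i \<in> {1..M} \<and> u \<in> {(real i - 1) * a ..< real i * a})
           in (u - (real i - 1) * a) / a
      else (u - real M * a) / (1 - real M * a))"

(* Only the values on the square matter; there the sets Omega_alpha a i and
   Omega_beta M a i, i = 1..M, form a partition when 0 < a < 1/M. *)
definition baker :: "nat \<Rightarrow> real \<Rightarrow> real \<times> real \<Rightarrow> real \<times> real" where
  "baker M a p =
     (if \<exists>i\<in>{1..M}. p \<in> Omega_alpha a i
      then let i = (THE i. i \<in> {1..M} \<and> p \<in> Omega_alpha a i)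
           in (tau M a (fst p), snd p / real M + (real i - 1) / real M)
      else let i = (THE i. i \<in> {1..M} \<and> p \<in> Omega_beta M a i)
           in (tau M a (fst p), real M * snd p - real i + 1))"

lemma half_open_step_unique:
  fixes u d :: real
  assumes "0 < d"
    and "u \<in> {(real i - 1) * d ..< real i * d}"
    and "u \<in> {(real j - 1) * d ..< real j * d}"
  shows "i = j"
proof -
  have "(real i - 1) * d < real j * d" "(real j - 1) * d < real i * d"
    using assms(2,3) by (meson atLeastLessThan_iff le_less_trans)+
  then have "real i - 1 < real j" "real j - 1 < real i"
    using assms(1) mult_less_cancel_right_pos by blast+
  then show ?thesis by linarith
qed

lemma Omega_beta_unique:
  assumes "i \<in> {1..M}" "j \<in> {1..M}" "p \<in> Omega_beta M a i" "p \<in> Omega_beta M a j"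
  shows "i = j"
proof -
  have M: "0 < real M" using assms(1) by auto
  have *: "(real i - 1) / real M \<le> snd p" "i \<noteq> M \<Longrightarrow> snd p < real i / real M"
    if "p \<in> Omega_beta M a i" for i
    using that by (auto simp: Omega_beta_def split: if_splits)
  show ?thesis
  proof (rule ccontr)
    assume "i \<noteq> j"
    then consider "i < j" | "j < i" by linarith
    then show False
    proof cases
      case 1
      then have "(real j - 1) / real M < real i / real M"
        using *(1)[OF assms(4)] *(2)[OF assms(3)] assms(2) by auto
      then have "real j - 1 < real i" using M by (simp add: divide_less_cancel)
      with 1 show False by linarith
    next
      case 2
      then have "(real i - 1) / real M < real j / real M"
        using *(1)[OF assms(3)] *(2)[OF assms(4)] assms(1) by auto
      then have "real i - 1 < real j" using M by (simp add: divide_less_cancel)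
      with 2 show False by linarith
    qed
  qed
qed

lemma tau_alpha:
  assumes "0 < a" "i \<in> {1..M}" "u \<in> {(real i - 1) * a ..< real i * a}"
  shows "tau M a u = (u - (real i - 1) * a) / a"
proof -
  have "(THE i. i \<in> {1..M} \<and> u \<in> {(real i - 1) * a ..< real i * a}) = i"
    using assms half_open_step_unique[OF assms(1)] by (intro the_equality) blast+
  moreover have "u < real M * a"
  proof -
    have "u < real i * a" using assms(3) by auto
    also have "\<dots> \<le> real M * a" using assms(1,2) by (intro mult_right_mono) auto
    finally show ?thesis .
  qed
  ultimately show ?thesis by (simp add: tau_def Let_def)
qed

lemma baker_alpha:
  assumes "0 < a" "i \<in> {1..M}" "(u, c) \<in> Omega_alpha a i"
  shows "baker M a (u, c) = (tau M a u, c / real M + (real i - 1) / real M)"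
proof -
  have "(THE i. i \<in> {1..M} \<and> (u, c) \<in> Omega_alpha a i) = i"
    using assms half_open_step_unique[OF assms(1)]
    unfolding Omega_alpha_def by (intro the_equality) blast+
  then show ?thesis using assms(2,3) by (auto simp: baker_def Let_def)
qed

lemma baker_beta:
  assumes "0 < a" "i \<in> {1..M}" "(u, c) \<in> Omega_beta M a i"
  shows "baker M a (u, c) = (tau M a u, real M * c - real i + 1)"
proof -
  have "(u, c) \<notin> Omega_alpha a j" if "j \<in> {1..M}" for j
  proof
    assume "(u, c) \<in> Omega_alpha a j"
    then have "u < real j * a" by (auto simp: Omega_alpha_def)
    also have "\<dots> \<le> real M * a" using assms(1) that by (intro mult_right_mono) auto
    finally show False using assms(3) by (auto simp: Omega_beta_def)
  qed
  moreover have "(THE i. i \<in> {1..M} \<and> (u, c) \<in> Omega_beta M a i) = i"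
    using assms Omega_beta_unique by (intro the_equality) blast+
  ultimately show ?thesis by (auto simp: baker_def Let_def)
qed

(* T_l o ... o T_k with T_j = baker M (a j); the identity if l < k. *)
definition baker_comp ::
    "nat \<Rightarrow> (nat \<Rightarrow> real) \<Rightarrow> nat \<Rightarrow> nat \<Rightarrow> real \<times> real \<Rightarrow> real \<times> real" where
  "baker_comp M a k l = fold (\<lambda>j. baker M (a j)) [k..<Suc l]"

(* Parameter sequences are indexed by k >= 1; a 0 is irrelevant. *)
definition a_inf :: "(nat \<Rightarrow> real) \<Rightarrow> real" where
  "a_inf a = (INF k\<in>{1..}. a k)"

definition a_sup :: "(nat \<Rightarrow> real) \<Rightarrow> real" where
  "a_sup a = (SUP k\<in>{1..}. a k)"

definition admissible :: "nat \<Rightarrow> (nat \<Rightarrow> real) \<Rightarrow> bool" where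
  "admissible M a \<longleftrightarrow>
     (\<forall>k\<ge>1. 0 < a k \<and> a k < 1 / (2 * real M)) \<and>
     max 0 ((4 * real M * a_sup a - 1) / (4 * (real M)\<^sup>2 * a_sup a)) < a_inf a \<and>
     a_inf a \<le> a_sup a \<and> a_sup a < 1 / (2 * real M)"


(* The suprema are taken in the extended reals, so that finiteness is a genuine condition. *)

definition lip_seminorm :: "(real \<times> real \<Rightarrow> real) \<Rightarrow> ereal" where
  "lip_seminorm r =
     (SUP (s, t) \<in> {(s, t). s \<in> square \<and> t \<in> square \<and> s \<noteq> t}.
        ereal (\<bar>r s - r t\<bar> / dist s t))"

(* Points of the n-fold power have components 1..n. *)
definition square_pow :: "nat \<Rightarrow> (nat \<Rightarrow> real \<times> real) set" where
  "square_pow n = {1..n} \<rightarrow>\<^sub>E square"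

definition holder_seminorm ::
    "real \<Rightarrow> nat \<Rightarrow> ((nat \<Rightarrow> real \<times> real) \<Rightarrow> real) \<Rightarrow> ereal" where
  "holder_seminorm \<theta> n F =
     (MAX i\<in>{1..n}. SUP x\<in>square_pow n.
        SUP (s, t) \<in> {(s, t). s \<in> square \<and> t \<in> square \<and> s \<noteq> t}.
          ereal (\<bar>F (x(i := s)) - F (x(i := t))\<bar> / dist s t powr \<theta>))"

definition separately_holder ::
    "real \<Rightarrow> nat \<Rightarrow> ((nat \<Rightarrow> real \<times> real) \<Rightarrow> real) \<Rightarrow> bool" where
  "separately_holder \<theta> n F \<longleftrightarrow> holder_seminorm \<theta> n F < \<infinity>"

definition sup_norm :: "nat \<Rightarrow> ((nat \<Rightarrow> real \<times> real) \<Rightarrow> real) \<Rightarrow> ereal" where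
  "sup_norm n F = (SUP x\<in>square_pow n. ereal \<bar>F x\<bar>)"

definition holder_norm ::
    "real \<Rightarrow> nat \<Rightarrow> ((nat \<Rightarrow> real \<times> real) \<Rightarrow> real) \<Rightarrow> ereal" where
  "holder_norm \<theta> n F = sup_norm n F + holder_seminorm \<theta> n F"


definition split_obs ::
    "nat \<Rightarrow> (nat \<Rightarrow> real) \<Rightarrow> nat \<Rightarrow> nat \<Rightarrow> (nat \<Rightarrow> nat) \<Rightarrow>
      ((nat \<Rightarrow> real \<times> real) \<Rightarrow> real) \<Rightarrow> real \<times> real \<Rightarrow> real \<times> real \<Rightarrow> real" where
  "split_obs M a n l idx F x y =
     F (\<lambda>j\<in>{1..n}. baker_comp M a 1 (idx j) (if j \<le> l then x else y))"

end

theory Submission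
  imports Defs
begin

text \<open>
  The transfer operator of a baker map averages over one step of a backward random walk: with
  probability \<open>M a\<close> the walk removes the first base-\<open>M\<close> digit \<open>i\<close> of the central coordinate and
  moves into the \<open>i\<close>-th \<open>\<alpha>\<close>-strip, otherwise it prepends a uniformly chosen digit and contracts the
  unstable coordinate. Run two such walks with the same random choices. Since \<open>M a < 1/2\<close>, the number
  of common leading digits drifts upwards, and the unstable coordinates separate only when there is no common
  digit. Hence a distance that combines \<open>r\<close> to the number of common digits with the distance of the unstable
  coordinates contracts on average by a uniform factor, and the transfer operators forget their starting
  point exponentially fast in the supremum norm.

  The average of \<open>f(x, T x)\<close>, where \<open>T\<close> is a composition of baker maps, is the average over \<open>z\<close> of
  the iterated transfer operator applied to \<open>f(\<cdot>, z)\<close> and evaluated at \<open>z\<close>; by the loss of memory it is close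
  to the average over independent \<open>x\<close> and \<open>z\<close>. Applied with the density absorbed into \<open>f\<close>, this gives
  a bound exponential in the gap, stronger than the stretched exponential one that is claimed.
\<close>

subsection \<open>Inverse branches and the transfer operator\<close>

text \<open>The inverse branches below are exact on the half-open square. On the closed one they fail on the
  edges \<open>u = 1\<close> and \<open>c = 1\<close>, where an inverse branch may leave the domain of its branch.\<close>

definition half_open_square :: "(real \<times> real) set" where
  "half_open_square = {0..<1} \<times> {0..<1}"

text \<open>A closed form by floors in place of definite descriptions.
  \<open>\<lfloor>fst x / a\<rfloor>\<close> is the index of the \<alpha>-strip counted from 0; the
  minimum with \<open>M - 1\<close> puts the edge \<open>snd x = 1\<close> into the closed last
  \<beta>-rectangle.\<close>

lemma baker_eq:
  assumes a: "0 < a" "real M * a < 1" and M: "M \<ge> 1" and x: "x \<in> square"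
  shows "baker M a x =
    (if fst x < real M * a
     then (fst x / a - of_int \<lfloor>fst x / a\<rfloor>, (snd x + of_int \<lfloor>fst x / a\<rfloor>) / real M)
     else ((fst x - real M * a) / (1 - real M * a),
           real M * snd x - of_int (min \<lfloor>real M * snd x\<rfloor> (int M - 1))))"
proof -
  obtain u c where uc: "x = (u, c)" by (cases x)
  have b: "0 \<le> u" "u \<le> 1" "0 \<le> c" "c \<le> 1" using x uc by (auto simp: square_def)
  show ?thesis
  proof (cases "u < real M * a")
    case True
    define n where "n = nat \<lfloor>u / a\<rfloor>"
    have n: "\<lfloor>u / a\<rfloor> = int n" using b a by (simp add: n_def)
    have f: "real n \<le> u / a" "u / a < real n + 1" using n by linarith+
    have lo: "real n * a \<le> u" and hi: "u < (real n + 1) * a"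
      using f by (simp_all only: pos_le_divide_eq[OF a(1)] pos_divide_less_eq[OF a(1)])
    have "real n * a < real M * a" using lo True by linarith
    then have nM: "n < M" using a by simp
    have i: "Suc n \<in> {1..M}" using nM by simp
    have t: "u \<in> {(real (Suc n) - 1) * a..<real (Suc n) * a}" using lo hi by (simp add: algebra_simps)
    have "(u, c) \<in> Omega_alpha a (Suc n)" using t b by (auto simp: Omega_alpha_def)
    from baker_alpha[OF a(1) i this] tau_alpha[OF a(1) i t]
    show ?thesis using True a n by (simp add: uc diff_divide_distrib add_divide_distrib)
  next
    case False
    define n where "n = nat (min \<lfloor>real M * c\<rfloor> (int M - 1))"
    have n: "min \<lfloor>real M * c\<rfloor> (int M - 1) = int n" using b M by (simp add: n_def)
    have i: "Suc n \<in> {1..M}" using M by (auto simp: n_def)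
    have lo: "real n \<le> real M * c" using n by linarith
    have hi: "real M * c < real n + 1" if "Suc n \<noteq> M"
    proof -
      have "int n \<noteq> int M - 1" using that by linarith
      then have "\<lfloor>real M * c\<rfloor> = int n" using n by linarith
      then show ?thesis by linarith
    qed
    have "(u, c) \<in> Omega_beta M a (Suc n)"
      using lo hi b False M by (auto simp: Omega_beta_def field_simps)
    from baker_beta[OF a(1) i this] False
    show ?thesis by (simp add: uc n tau_def)
  qed
qed

lemma half_open_square_subset: "half_open_square \<subseteq> square"
  by (auto simp: half_open_square_def square_def)

section \<open>Forward invariance of the closed and of the half-open square\<close>

lemma floor_divide_bounds:
  assumes "0 < (a::real)"
  shows "of_int \<lfloor>u / a\<rfloor> * a \<le> u" "u - of_int \<lfloor>u / a\<rfloor> * a < a"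
proof -
  have "of_int \<lfloor>u / a\<rfloor> \<le> u / a" "u / a < of_int \<lfloor>u / a\<rfloor> + 1" by linarith+
  then have "of_int \<lfloor>u / a\<rfloor> * a \<le> u" "u < (of_int \<lfloor>u / a\<rfloor> + 1) * a"
    using assms by (simp_all only: pos_le_divide_eq pos_divide_less_eq)
  then show "of_int \<lfloor>u / a\<rfloor> * a \<le> u" "u - of_int \<lfloor>u / a\<rfloor> * a < a"
    by (simp_all add: algebra_simps)
qed

lemma baker_in_square:
  assumes a: "0 < a" "real M * a < 1" and M: "M \<ge> 1" and x: "x \<in> square"
  shows "baker M a x \<in> square"
proof -
  have b: "0 \<le> fst x" "fst x \<le> 1" "0 \<le> snd x" "snd x \<le> 1" using x by (auto simp: square_def)
  show ?thesis
  proof (cases "fst x < real M * a")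
    case True
    have "0 \<le> \<lfloor>fst x / a\<rfloor>" using b a by simp
    have "fst x / a < real M" using True a by (simp add: field_simps)
    then have "\<lfloor>fst x / a\<rfloor> \<le> int M - 1" by linarith
    then have "real_of_int \<lfloor>fst x / a\<rfloor> \<le> real M - 1" by linarith
    then show ?thesis using \<open>0 \<le> \<lfloor>fst x / a\<rfloor>\<close> True b M unfolding baker_eq[OF a M x]
      using a floor_divide_bounds[OF a(1), of "fst x"]
      by (auto simp: square_def divide_simps)
  next
    case False
    have "real M * snd x \<le> real M" using b M mult_left_le[of "snd x" "real M"] by (simp add: mult.commute)
    then have "real M * snd x - of_int (min \<lfloor>real M * snd x\<rfloor> (int M - 1)) \<in> {0..1}"
      by (auto simp: min_def) linarith+
    then show ?thesis using False a b unfolding baker_eq[OF a M x]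
      by (auto simp: square_def divide_simps)
  qed
qed

lemma baker_in_half_open_square:
  assumes a: "0 < a" "real M * a < 1" and M: "M \<ge> 1" and x: "x \<in> half_open_square"
  shows "baker M a x \<in> half_open_square"
proof -
  have x': "x \<in> square" using x half_open_square_subset by auto
  have b: "0 \<le> fst x" "fst x < 1" "0 \<le> snd x" "snd x < 1" using x by (auto simp: half_open_square_def)
  show ?thesis
  proof (cases "fst x < real M * a")
    case True
    have "0 \<le> \<lfloor>fst x / a\<rfloor>" using b a by simp
    have "fst x / a < real M" using True a by (simp add: field_simps)
    then have "\<lfloor>fst x / a\<rfloor> \<le> int M - 1" by linarith
    then have "real_of_int \<lfloor>fst x / a\<rfloor> \<le> real M - 1" by linarith
    then show ?thesis using \<open>0 \<le> \<lfloor>fst x / a\<rfloor>\<close> True b M unfolding baker_eq[OF a M x']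
      using a floor_divide_bounds[OF a(1), of "fst x"]
      by (auto simp: half_open_square_def divide_simps)
  next
    case False
    have "real M * snd x < real M" using b M by simp
    then have "real M * snd x - of_int (min \<lfloor>real M * snd x\<rfloor> (int M - 1)) \<in> {0..<1}"
      by (auto simp: min_def) linarith+
    then show ?thesis using False a b unfolding baker_eq[OF a M x']
      by (auto simp: half_open_square_def divide_simps)
  qed
qed

text \<open>The \<alpha>-strips of the half-open square are mapped onto disjoint horizontal bands,
  one for each first digit. So a point has a single preimage in the \<alpha>-strips, and its first
  digit names the strip.\<close>

definition alpha_pre :: "nat \<Rightarrow> real \<Rightarrow> real \<times> real \<Rightarrow> real \<times> real" where
  "alpha_pre M a x = (a * (fst x + of_int \<lfloor>real M * snd x\<rfloor>), real M * snd x - of_int \<lfloor>real M * snd x\<rfloor>)"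

text \<open>The image of every \<beta>-rectangle covers the half-open square, so each digit
  \<open>i\<close>, counted from 0, yields a preimage.\<close>

definition beta_pre :: "nat \<Rightarrow> real \<Rightarrow> nat \<Rightarrow> real \<times> real \<Rightarrow> real \<times> real" where
  "beta_pre M a i x = (real M * a + (1 - real M * a) * fst x, (snd x + real i) / real M)"

lemma digit_bounds:
  assumes "x \<in> half_open_square"
  shows "0 \<le> \<lfloor>real M * snd x\<rfloor>" "M \<ge> 1 \<Longrightarrow> \<lfloor>real M * snd x\<rfloor> \<le> int M - 1"
proof -
  have b: "0 \<le> snd x" "snd x < 1" using assms by (auto simp: half_open_square_def)
  then show "0 \<le> \<lfloor>real M * snd x\<rfloor>" by simp
  assume "M \<ge> 1"
  then have "real M * snd x < real M" using b by simp
  then show "\<lfloor>real M * snd x\<rfloor> \<le> int M - 1" by linarith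
qed

lemma alpha_pre_props:
  assumes a: "0 < a" "real M * a < 1" and M: "M \<ge> 1" and x: "x \<in> half_open_square"
  shows "alpha_pre M a x \<in> half_open_square" "baker M a (alpha_pre M a x) = x"
proof -
  define d where "d = \<lfloor>real M * snd x\<rfloor>"
  have d: "0 \<le> d" "d \<le> int M - 1" using digit_bounds[OF x] M by (auto simp: d_def)
  then have d': "0 \<le> real_of_int d" "real_of_int d \<le> real M - 1" by linarith+
  have b: "0 \<le> fst x" "fst x < 1" "0 \<le> snd x" "snd x < 1" using x by (auto simp: half_open_square_def)
  have "fst x + of_int d < real M" using d' b by linarith
  then have lt: "a * (fst x + of_int d) < real M * a" using a by (simp add: mult.commute)
  then have "a * (fst x + of_int d) < 1" using a by linarith
  moreover have "real M * snd x - of_int d \<in> {0..<1}" unfolding d_def by auto linarith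
  ultimately show *: "alpha_pre M a x \<in> half_open_square"
    using a b d' unfolding alpha_pre_def d_def[symmetric] by (auto simp: half_open_square_def)
  then have s: "alpha_pre M a x \<in> square" using half_open_square_subset by auto
  have "\<lfloor>fst x + of_int d\<rfloor> = d" using b by (simp add: floor_eq_iff)
  then show "baker M a (alpha_pre M a x) = x"
    unfolding baker_eq[OF a M s] using lt a M unfolding alpha_pre_def d_def[symmetric]
    by (simp add: prod_eq_iff)
qed

lemma beta_pre_props:
  assumes a: "0 < a" "real M * a < 1" and i: "i < M" and x: "x \<in> half_open_square"
  shows "beta_pre M a i x \<in> half_open_square" "baker M a (beta_pre M a i x) = x"
proof -
  have M: "M \<ge> 1" using i by simp
  have b: "0 \<le> fst x" "fst x < 1" "0 \<le> snd x" "snd x < 1" using x by (auto simp: half_open_square_def)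
  have i': "real i \<le> real M - 1" using i by linarith
  have 1: "0 \<le> (1 - real M * a) * fst x" "(1 - real M * a) * fst x < 1 - real M * a"
    using a b by auto
  then have 2: "real M * a + (1 - real M * a) * fst x < 1" by linarith
  show *: "beta_pre M a i x \<in> half_open_square"
    unfolding beta_pre_def half_open_square_def
    using 1 a b M i' by (auto simp: pos_divide_less_eq intro: 2)
  then have s: "beta_pre M a i x \<in> square" using half_open_square_subset by auto
  have "\<lfloor>snd x + real i\<rfloor> = int i" using b by (simp add: floor_eq_iff)
  then show "baker M a (beta_pre M a i x) = x"
    unfolding baker_eq[OF a M s] using a M i 1 unfolding beta_pre_def
    by (auto simp: prod_eq_iff min_def)
qed

text \<open>The Perron-Frobenius operator for Lebesgue measure. The weights are the inverse
  Jacobians, \<open>M * a\<close> for \<alpha> and \<open>(1 - M * a) / M\<close> for each of the M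
  \<beta>-branches; they sum to 1.\<close>

definition transfer :: "nat \<Rightarrow> real \<Rightarrow> (real \<times> real \<Rightarrow> real) \<Rightarrow> real \<times> real \<Rightarrow> real" where
  "transfer M a G x = real M * a * G (alpha_pre M a x)
     + (1 - real M * a) / real M * (\<Sum>i<M. G (beta_pre M a i x))"

text \<open>The expectation of \<open>S\<close> after one backward step of two walks that make the same choices.\<close>

definition coupled_transfer ::
    "nat \<Rightarrow> real \<Rightarrow> (real \<times> real \<Rightarrow> real \<times> real \<Rightarrow> real) \<Rightarrow> real \<times> real \<Rightarrow> real \<times> real \<Rightarrow> real" where
  "coupled_transfer M a S x y = real M * a * S (alpha_pre M a x) (alpha_pre M a y)
     + (1 - real M * a) / real M * (\<Sum>i<M. S (beta_pre M a i x) (beta_pre M a i y))"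

text \<open>As the weights sum to 1, a constant passes through unchanged. Error terms common to all
  branches can thus be carried along.\<close>

lemma coupled_transfer_affine:
  assumes "M \<ge> 1"
  shows "coupled_transfer M a (\<lambda>v w. c * S v w + R) x y = c * coupled_transfer M a S x y + R"
proof -
  define s where "s = (\<Sum>i<M. S (beta_pre M a i x) (beta_pre M a i y))"
  have "(\<Sum>i<M. c * S (beta_pre M a i x) (beta_pre M a i y) + R) = c * s + real M * R"
    by (simp add: s_def sum.distrib sum_distrib_left)
  then show ?thesis unfolding coupled_transfer_def s_def[symmetric] using assms by (simp add: field_simps)
qed

subsection \<open>Average contraction of the coupled inverse branches\<close>

text \<open>For c in [0,1), \<open>\<lfloor>M ^ h * c\<rfloor>\<close> encodes the first h base-M
  digits of c.\<close>

definition agree :: "nat \<Rightarrow> nat \<Rightarrow> real \<Rightarrow> real \<Rightarrow> bool" where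
  "agree M h c c' \<longleftrightarrow> \<lfloor>real M ^ h * c\<rfloor> = \<lfloor>real M ^ h * c'\<rfloor>"

text \<open>This is \<open>r\<close> to the number of common leading base-\<open>M\<close> digits. An ultrametric is needed in place of
  \<open>|c - c'|\<close>: the \<open>\<alpha>\<close>-branch is chosen by the first digit, which may differ for arbitrarily close points.\<close>

definition digit_dist :: "nat \<Rightarrow> real \<Rightarrow> real \<Rightarrow> real \<Rightarrow> real" where
  "digit_dist M r c c' = (INF h\<in>{h. agree M h c c'}. r ^ h)"

lemma agree_0: "c \<in> {0..<1} \<Longrightarrow> c' \<in> {0..<1} \<Longrightarrow> agree M 0 c c'"
  by (simp add: agree_def floor_unique[where z=0])

lemma agree_Suc_append:
  assumes "agree M h c c'" "M \<ge> 1"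
  shows "agree M (Suc h) ((c + real i) / real M) ((c' + real i) / real M)"
proof -
  have "real M ^ Suc h * ((x + real i) / real M) = real M ^ h * x + of_int (int (M ^ h * i))" for x
    using assms(2) by (simp add: field_simps)
  then show ?thesis using assms(1) by (simp only: agree_def flip: floor_add_int)
qed

lemma agree_Suc_drop:
  assumes "agree M (Suc h) c c'"
  shows "agree M h (real M * c - of_int j) (real M * c' - of_int j)"
proof -
  have "real M ^ h * (real M * x - of_int j) = real M ^ Suc h * x - of_int (int (M ^ h) * j)" for x
    by (simp add: algebra_simps)
  then show ?thesis using assms by (simp only: agree_def floor_diff_of_int)
qed

text \<open>Integer division by \<open>M ^ h\<close> discards all but the first of the
  \<open>Suc h\<close> encoded digits.\<close>

lemma agree_first_digit:
  assumes "agree M (Suc h) c c'" and "M \<ge> 1"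
  shows "\<lfloor>real M * c\<rfloor> = \<lfloor>real M * c'\<rfloor>"
proof -
  have "\<lfloor>real M * x\<rfloor> = \<lfloor>real M ^ Suc h * x\<rfloor> div (int (M ^ h))" for x
  proof -
    have "real M * x = (real M ^ Suc h * x) / real_of_int (int (M ^ h))"
      using assms(2) by simp
    then show ?thesis by (simp only: floor_divide_real_eq_div)
  qed
  then show ?thesis using assms(1) by (simp add: agree_def)
qed

lemma agree_imp_close:
  assumes "agree M h c c'" and "M \<ge> 1"
  shows "\<bar>c - c'\<bar> \<le> (1 / real M) ^ h"
proof -
  have "\<bar>real M ^ h * c - real M ^ h * c'\<bar> < 1"
    using assms(1) unfolding agree_def by linarith
  then have "real M ^ h * \<bar>c - c'\<bar> < 1"
    by (simp add: abs_mult flip: right_diff_distrib)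
  then show ?thesis using assms(2) by (simp add: power_one_over field_simps)
qed

section \<open>The digit ultrametric when a digit is prepended or dropped\<close>

context
  fixes M :: nat and r :: real
  assumes M: "M \<ge> 1" and r: "0 < r" "r < 1"
begin

lemma digit_dist_bdd: "bdd_below ((\<lambda>h. r ^ h) ` A)"
  using r by (intro bdd_belowI2[of _ 0]) simp

lemma digit_dist_le: "agree M h c c' \<Longrightarrow> digit_dist M r c c' \<le> r ^ h"
  unfolding digit_dist_def using digit_dist_bdd by (intro cINF_lower) auto

lemma digit_dist_greatest:
  "c \<in> {0..<1} \<Longrightarrow> c' \<in> {0..<1} \<Longrightarrow> (\<And>h. agree M h c c' \<Longrightarrow> e \<le> r ^ h) \<Longrightarrow> e \<le> digit_dist M r c c'"
  unfolding digit_dist_def using agree_0 by (intro cINF_greatest) blast+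

lemma digit_dist_bounds:
  assumes "c \<in> {0..<1}" "c' \<in> {0..<1}"
  shows "0 \<le> digit_dist M r c c'" "digit_dist M r c c' \<le> 1"
  using digit_dist_greatest[OF assms, of 0] digit_dist_le[OF agree_0[OF assms]] r by simp_all

lemma digit_dist_append:
  assumes "c \<in> {0..<1}" "c' \<in> {0..<1}"
  shows "digit_dist M r ((c + real i) / real M) ((c' + real i) / real M) \<le> r * digit_dist M r c c'"
proof -
  have "digit_dist M r ((c + real i) / real M) ((c' + real i) / real M) / r \<le> digit_dist M r c c'"
    using digit_dist_le[OF agree_Suc_append[OF _ M]] r
    by (intro digit_dist_greatest assms) (simp add: field_simps)
  then show ?thesis using r by (simp add: field_simps)
qed

lemma digit_dist_drop:
  assumes c: "c \<in> {0..<1}" "c' \<in> {0..<1}" and eq: "\<lfloor>real M * c\<rfloor> = \<lfloor>real M * c'\<rfloor>"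
  shows "digit_dist M r (real M * c - of_int \<lfloor>real M * c\<rfloor>) (real M * c' - of_int \<lfloor>real M * c'\<rfloor>)
    \<le> digit_dist M r c c' / r"
proof -
  let ?D = "digit_dist M r (real M * c - of_int \<lfloor>real M * c\<rfloor>) (real M * c' - of_int \<lfloor>real M * c'\<rfloor>)"
  have "r * ?D \<le> r ^ h" if "agree M h c c'" for h
  proof (cases h)
    \<comment> \<open>Agreement to depth 0 leaves no digit to drop, so the trivial bound
      \<open>?D \<le> 1\<close> has to serve.\<close>
    case 0
    have "real M * z - of_int \<lfloor>real M * z\<rfloor> \<in> {0..<1}" for z :: real by simp linarith
    then have "0 \<le> ?D" "?D \<le> 1" using digit_dist_bounds by blast+
    then have "r * ?D \<le> 1 * 1" using r by (intro mult_mono) auto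
    then show ?thesis by (simp add: 0)
  next
    case (Suc n)
    then show ?thesis
      using digit_dist_le[OF agree_Suc_drop[of M n c c' "\<lfloor>real M * c\<rfloor>"]] that r eq by simp
  qed
  from digit_dist_greatest[OF c this] show ?thesis using r by (simp add: field_simps)
qed

lemma digit_dist_first_digit:
  assumes "c \<in> {0..<1}" "c' \<in> {0..<1}" and "\<lfloor>real M * c\<rfloor> \<noteq> \<lfloor>real M * c'\<rfloor>"
  shows "digit_dist M r c c' = 1"
proof (rule antisym)
  have "h = 0" if "agree M h c c'" for h
    using agree_first_digit[OF _ M] that assms(3) by (cases h) auto
  then show "1 \<le> digit_dist M r c c'" by (intro digit_dist_greatest assms(1,2)) fastforce
qed (rule digit_dist_bounds[OF assms(1,2)])

text \<open>Agreement to depth h forces a distance of at most \<open>(1 / M) ^ h\<close>, and the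
  lower bound on r makes the power \<theta> of this at most \<open>r ^ h\<close>.\<close>

lemma powr_le_digit_dist:
  assumes c: "c \<in> {0..<1}" "c' \<in> {0..<1}" and t: "0 < \<theta>" "(1 / real M) powr \<theta> \<le> r"
  shows "\<bar>c - c'\<bar> powr \<theta> \<le> digit_dist M r c c'"
proof (rule digit_dist_greatest[OF c])
  fix h assume "agree M h c c'"
  then have "\<bar>c - c'\<bar> powr \<theta> \<le> ((1 / real M) ^ h) powr \<theta>"
    using agree_imp_close[OF _ M] t by (intro powr_mono2) auto
  also have "\<dots> = ((1 / real M) powr \<theta>) ^ h"
    using M by (simp add: powr_powr mult.commute flip: powr_realpow)
  also have "\<dots> \<le> r ^ h" using t by (intro power_mono) auto
  finally show "\<bar>c - c'\<bar> powr \<theta> \<le> r ^ h" .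
qed

end

text \<open>The quotients \<open>u / (u + c)\<close> and \<open>c / (u + c)\<close> sum to 1 and lie
  in [0,1], where raising to a power \<theta> \<le> 1 does not decrease a number.\<close>

lemma powr_add_le:
  assumes "0 \<le> u" "0 \<le> c" "0 < \<theta>" "\<theta> \<le> (1::real)"
  shows "(u + c) powr \<theta> \<le> u powr \<theta> + c powr \<theta>"
proof (cases "u + c = 0")
  case True
  then show ?thesis using assms by simp
next
  case False
  then have s: "0 < u + c" using assms by simp
  have *: "w / (u + c) \<le> w powr \<theta> / (u + c) powr \<theta>" if "0 \<le> w" "w \<le> u + c" for w
  proof (cases "w = 0")
    case False
    then have "(w / (u + c)) powr 1 \<le> (w / (u + c)) powr \<theta>"
      using that s assms by (intro powr_mono') auto
    then show ?thesis using that s False by (simp add: powr_divide)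
  qed simp
  have "1 = u / (u + c) + c / (u + c)" using s by (simp flip: add_divide_distrib)
  also have "\<dots> \<le> u powr \<theta> / (u + c) powr \<theta> + c powr \<theta> / (u + c) powr \<theta>"
    using assms by (intro add_mono *) auto
  finally show ?thesis using s by (simp add: divide_simps)
qed

text \<open>The weight \<open>1 / r - 1\<close> bounds the distance by \<open>1 / r\<close>. A step \<open>\<alpha>\<close> without common digits thus
  costs no more than the loss of a common digit.\<close>

definition coupling_dist :: "nat \<Rightarrow> real \<Rightarrow> real \<Rightarrow> real \<times> real \<Rightarrow> real \<times> real \<Rightarrow> real" where
  "coupling_dist M r \<theta> x y =
     digit_dist M r (snd x) (snd y) + (1 / r - 1) * \<bar>fst x - fst y\<bar> powr \<theta>"

text \<open>The first bound on \<open>lam\<close> is the worst mean growth of the digit part: with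
  probability at most \<open>M * a_up\<close> a digit is lost at cost \<open>1 / r\<close>,
  otherwise one is gained with factor r. The second is the contraction of the unstable coordinate
  along \<beta>, to the power \<theta>.\<close>

locale coupling =
  fixes M :: nat and \<theta> a_low a_up r lam :: real
  assumes M: "M \<ge> 1" and \<theta>: "0 < \<theta>" "\<theta> \<le> 1" and a_low: "0 < a_low" and a_up: "a_up < 1 / (2 * real M)"
    and r: "0 < r" "r < 1" "(1 / real M) powr \<theta> \<le> r"
    and lam: "real M * a_up / r + (1 - real M * a_up) * r \<le> lam"
      "(1 - real M * a_low) powr \<theta> \<le> lam" "lam < 1"
begin

abbreviation V where "V \<equiv> coupling_dist M r \<theta>"

lemma V_bounds:
  assumes "x \<in> half_open_square" "y \<in> half_open_square"
  shows "0 \<le> V x y" "V x y \<le> 1 / r"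
proof -
  have b: "snd x \<in> {0..<1}" "snd y \<in> {0..<1}" "\<bar>fst x - fst y\<bar> \<le> 1"
    using assms by (auto simp: half_open_square_def)
  define E where "E = (1 / r - 1) * \<bar>fst x - fst y\<bar> powr \<theta>"
  have "\<bar>fst x - fst y\<bar> powr \<theta> \<le> 1" using b \<theta> by (intro powr_le1) auto
  then have "E \<le> (1 / r - 1) * 1" unfolding E_def using r by (intro mult_left_mono) auto
  moreover have "0 \<le> E" unfolding E_def using r by simp
  ultimately show "0 \<le> V x y" "V x y \<le> 1 / r"
    using digit_dist_bounds[OF M r(1,2) b(1,2)] unfolding coupling_dist_def E_def[symmetric]
    by simp_all
qed

text \<open>The denominator is the smaller of the weights that \<open>V\<close> gives to its two
  parts.\<close>

lemma dist_powr_le_V: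
  assumes x: "x \<in> half_open_square" "y \<in> half_open_square"
  shows "dist x y powr \<theta> \<le> V x y / min 1 (1 / r - 1)"
proof -
  have b: "snd x \<in> {0..<1}" "snd y \<in> {0..<1}"
    using x by (auto simp: half_open_square_def)
  define d where "d = min 1 (1 / r - 1)"
  have d: "0 < d" "d \<le> 1" "d \<le> 1 / r - 1" using r by (auto simp: d_def)
  let ?u = "\<bar>fst x - fst y\<bar>" and ?c = "\<bar>snd x - snd y\<bar>"
  have "dist x y \<le> ?u + ?c"
    using sqrt_sum_squares_le_sum_abs[of "fst x - fst y" "snd x - snd y"]
    by (simp add: dist_prod_def dist_real_def)
  then have "dist x y powr \<theta> \<le> (?u + ?c) powr \<theta>" using \<theta> by (intro powr_mono2) auto
  also have "\<dots> \<le> ?u powr \<theta> + ?c powr \<theta>" using \<theta> by (intro powr_add_le) auto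
  finally have "d * dist x y powr \<theta> \<le> d * ?u powr \<theta> + d * ?c powr \<theta>"
    using d by (simp flip: distrib_left)
  also have "\<dots> \<le> (1 / r - 1) * ?u powr \<theta> + 1 * ?c powr \<theta>"
    using d by (intro add_mono mult_right_mono) auto
  also have "\<dots> \<le> V x y"
    using powr_le_digit_dist[OF M r(1,2) b \<theta>(1) r(3)] by (simp add: coupling_dist_def)
  finally show ?thesis using d unfolding d_def[symmetric] by (simp add: field_simps)
qed

text \<open>The digit part shrinks by the drift of the number of common digits, and the unstable
  part shrinks along every branch, unless an \<alpha>-step meets different first digits. That case
  is paid for by the digit part, which is then maximal.\<close>

lemma coupling_contraction:
  assumes a: "a_low \<le> a" "a \<le> a_up" and x: "x \<in> half_open_square" "y \<in> half_open_square"
  shows "coupled_transfer M a V x y \<le> lam * V x y"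
proof -
  define b where "b = real M * a"
  define d where "d = 1 / r - 1"
  define W where "W = digit_dist M r (snd x) (snd y)"
  define E where "E = \<bar>fst x - fst y\<bar> powr \<theta>"
  have sx: "snd x \<in> {0..<1}" "snd y \<in> {0..<1}" using x by (auto simp: half_open_square_def)
  have a0: "0 < a" using a a_low by linarith
  have "b \<le> real M * a_up" using a M by (simp add: b_def)
  moreover have bu: "real M * a_up < 1 / 2" using a_up M by (simp add: field_simps)
  ultimately have b: "0 < b" "b < 1 / 2" "b \<le> real M * a_up" using mult_pos_pos[of "real M" a] a0 M unfolding b_def by linarith+
  have ab: "a \<le> b" using a0 M by (simp add: b_def)
  have d: "0 < d" using r by (simp add: d_def)
  have W: "0 \<le> W" "W \<le> 1" using digit_dist_bounds[OF M r(1,2) sx] by (auto simp: W_def)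
  have E: "0 \<le> E" by (simp add: E_def)
  define t where "t = (1 - b) powr \<theta>"
  have "t \<le> (1 - real M * a_low) powr \<theta>"
    unfolding t_def b_def using a M b \<theta> by (intro powr_mono2) (auto simp: b_def)
  then have t: "0 < t" "t \<le> lam" using lam b by (auto simp: t_def)
  \<comment> \<open>Here \<open>a \<le> b < 1 / 2 < 1 - b\<close>, so \<alpha> contracts the
    unstable coordinate no less than \<beta> does.\<close>
  have "a powr \<theta> \<le> t" unfolding t_def using a0 ab b \<theta> by (intro powr_mono2) auto
  then have at: "a powr \<theta> \<le> lam" using t by linarith
  \<comment> \<open>The left-hand side is \<open>r + b * (1 / r - r)\<close>, which grows with b, so
    \<open>b = M * a_up\<close> is the worst case.\<close>
  have bl: "b / r + (1 - b) * r \<le> lam"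
  proof -
    have "b * (1 / r - r) \<le> real M * a_up * (1 / r - r)"
      using b r mult_strict_mono[of r 1 r 1]
      by (intro mult_right_mono) (auto simp: field_simps)
    then show ?thesis using lam(1) by (simp add: algebra_simps)
  qed
  have beta: "V (beta_pre M a i x) (beta_pre M a i y) \<le> r * W + d * (lam * E)" if "i < M" for i
  proof -
    have "fst (beta_pre M a i x) - fst (beta_pre M a i y) = (1 - b) * (fst x - fst y)"
      by (simp add: beta_pre_def b_def algebra_simps)
    then have "\<bar>fst (beta_pre M a i x) - fst (beta_pre M a i y)\<bar> powr \<theta> = t * E"
      using b by (simp add: abs_mult powr_mult t_def E_def)
    also have "\<dots> \<le> lam * E" using t E by (intro mult_right_mono) auto
    finally show ?thesis
      using digit_dist_append[OF M r(1,2) sx, of i] d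
      unfolding coupling_dist_def W_def d_def[symmetric] by (intro add_mono mult_left_mono) (auto simp: beta_pre_def)
  qed
  have "(\<Sum>i<M. V (beta_pre M a i x) (beta_pre M a i y)) \<le> real M * (r * W + d * (lam * E))"
    using beta by (intro sum_bounded_above[where A="{..<M}", simplified]) auto
  then have "(1 - b) / real M * (\<Sum>i<M. V (beta_pre M a i x) (beta_pre M a i y))
      \<le> (1 - b) / real M * (real M * (r * W + d * (lam * E)))"
    using b by (intro mult_left_mono) auto
  then have beta': "(1 - b) / real M * (\<Sum>i<M. V (beta_pre M a i x) (beta_pre M a i y))
      \<le> (1 - b) * (r * W + d * (lam * E))" using M by simp
  have "b * V (alpha_pre M a x) (alpha_pre M a y) + (1 - b) * (r * W + d * (lam * E)) \<le> lam * (W + d * E)"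
  proof (cases "\<lfloor>real M * snd x\<rfloor> = \<lfloor>real M * snd y\<rfloor>")
    case True
    then have "fst (alpha_pre M a x) - fst (alpha_pre M a y) = a * (fst x - fst y)"
      by (simp add: alpha_pre_def algebra_simps)
    then have "\<bar>fst (alpha_pre M a x) - fst (alpha_pre M a y)\<bar> powr \<theta> = a powr \<theta> * E"
      using a0 by (simp add: abs_mult powr_mult E_def)
    also have "\<dots> \<le> lam * E" using at E by (intro mult_right_mono) auto
    finally have "V (alpha_pre M a x) (alpha_pre M a y) \<le> W / r + d * (lam * E)"
      using digit_dist_drop[OF M r(1,2) sx True] d
      unfolding coupling_dist_def W_def d_def[symmetric]
      by (intro add_mono mult_left_mono) (auto simp: alpha_pre_def)
    then have "b * V (alpha_pre M a x) (alpha_pre M a y) \<le> b * (W / r + d * (lam * E))"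
      using b by (intro mult_left_mono) auto
    moreover have "(b / r + (1 - b) * r) * W \<le> lam * W" using bl W by (intro mult_right_mono) auto
    ultimately show ?thesis by (simp add: algebra_simps)
  next
    case False
    \<comment> \<open>As \<open>W = 1\<close>, the crude bound \<open>1 / r\<close> on
      \<open>V\<close> equals \<open>W / r\<close>, the cost of a lost digit, so \<open>bl\<close>
      covers this case too.\<close>
    then have W1: "W = 1" unfolding W_def by (rule digit_dist_first_digit[OF M r(1,2) sx])
    have "V (alpha_pre M a x) (alpha_pre M a y) \<le> 1 / r"
      using a0 b x M by (intro V_bounds alpha_pre_props) (auto simp: b_def)
    then have "b * V (alpha_pre M a x) (alpha_pre M a y) \<le> b * (1 / r)"
      using b by (intro mult_left_mono) auto
    moreover have "(1 - b) * (d * (lam * E)) \<le> 1 * (d * (lam * E))"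
      using b d t E by (intro mult_right_mono) auto
    ultimately show ?thesis using bl W1 by (simp add: algebra_simps)
  qed
  then show ?thesis using beta' unfolding coupling_dist_def[of _ _ _ x y] coupled_transfer_def
    by (simp add: b_def W_def E_def d_def)
qed

end

subsection \<open>Invariance of Lebesgue measure\<close>

lemma set_integrable_bounded:
  fixes f :: "'a::euclidean_space \<Rightarrow> real"
  assumes f: "f \<in> borel_measurable borel" and K: "\<And>x. \<bar>f x\<bar> \<le> K"
    and A: "A \<in> sets borel" "bounded A"
  shows "set_integrable lborel A f"
proof -
  have "integrable lborel (\<lambda>x. indicat_real A x * K)"
    using A by (intro integrable_mult_left integrable_real_indicator emeasure_bounded_finite) auto
  then show ?thesis unfolding set_integrable_def
  proof (rule Bochner_Integration.integrable_bound)
    show "(\<lambda>x. indicat_real A x *\<^sub>R f x) \<in> borel_measurable lborel" using f A by simp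
    show "AE x in lborel. norm (indicat_real A x *\<^sub>R f x) \<le> norm (indicat_real A x * K)"
      using K by (intro AE_I2) (auto simp: indicator_def intro: order_trans[OF K])
  qed
qed

lemma set_integral_sum:
  fixes f :: "'i \<Rightarrow> 'a \<Rightarrow> real"
  assumes "\<And>i. i \<in> I \<Longrightarrow> set_integrable N A (f i)"
  shows "(LINT x:A|N. \<Sum>i\<in>I. f i x) = (\<Sum>i\<in>I. LINT x:A|N. f i x)"
    and "set_integrable N A (\<lambda>x. \<Sum>i\<in>I. f i x)"
  using assms unfolding set_lebesgue_integral_def set_integrable_def
  by (simp_all add: sum_distrib_left Bochner_Integration.integral_sum)

lemma unit_integral_bound:
  fixes f :: "real \<Rightarrow> real"
  assumes f: "f \<in> borel_measurable borel" and K: "\<And>x. \<bar>f x\<bar> \<le> K"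
  shows "\<bar>LINT c:{0..<1}|lborel. f c\<bar> \<le> K"
proof -
  have si: "set_integrable lborel {0..<1} f"
    using assms by (intro set_integrable_bounded) auto
  have "\<bar>LINT c:{0..<1}|lborel. f c\<bar> \<le> (LINT c:{0..<1}|lborel. \<bar>f c\<bar>)"
    using set_integral_norm_bound[OF si] by simp
  also have "\<dots> \<le> (LINT c:{0..<1::real}|lborel. K)"
    using K si by (intro set_integral_mono set_integrable_bounded[where K=K and f="\<lambda>_. K"] set_integrable_abs)
      (auto intro: order_trans[OF abs_ge_zero K])
  also have "\<dots> = K" by (simp add: set_integral_const)
  finally show ?thesis .
qed

lemma set_integral_affine:
  fixes f :: "real \<Rightarrow> real"
  assumes "0 < e"
  shows "(LINT x:{s..<s + e}|lborel. f x) = e * (LINT u:{0..<1}|lborel. f (s + e * u))"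
proof -
  have "(LINT x:{s..<s + e}|lborel. f x)
      = \<bar>e\<bar> *\<^sub>R (\<integral>u. indicat_real {s..<s + e} (s + e * u) *\<^sub>R f (s + e * u) \<partial>lborel)"
    unfolding set_lebesgue_integral_def using assms by (intro lborel_integral_real_affine) simp
  also have "(\<lambda>u. indicat_real {s..<s + e} (s + e * u)) = indicat_real {0..<1}"
    using assms by (auto simp: indicator_def zero_le_mult_iff)
  finally show ?thesis using assms by (simp add: set_lebesgue_integral_def)
qed

text \<open>The unit interval is cut into M pieces of length a and a remainder, each rescaled to
  unit length. This serves the unstable direction and, with \<open>a = 1 / M\<close> and an empty
  remainder, the central one.\<close>

lemma set_integral_step:
  fixes f :: "real \<Rightarrow> real"
  assumes f: "f \<in> borel_measurable borel" "\<And>x. \<bar>f x\<bar> \<le> K" and a: "0 < a" "real M * a \<le> 1"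
  shows "(LINT u:{0..<1}|lborel. f u) = (\<Sum>i<M. a * (LINT u:{0..<1}|lborel. f (a * (u + real i))))
     + (1 - real M * a) * (LINT u:{0..<1}|lborel. f (real M * a + (1 - real M * a) * u))"
proof -
  have int: "set_integrable lborel {s..<t} f" for s t
    using f by (intro set_integrable_bounded) auto
  have join: "(LINT x:{0..<t}|lborel. f x) = (LINT x:{0..<s}|lborel. f x) + (LINT x:{s..<t}|lborel. f x)"
    if "0 \<le> s" "s \<le> t" for s t
  proof -
    have "{0..<t} = {0..<s} \<union> {s..<t}" using that by auto
    then show ?thesis using set_integral_Un[of "{0..<s}" "{s..<t}" lborel f] int by auto
  qed
  have "(LINT x:{0..<real n * a}|lborel. f x) = (\<Sum>i<n. a * (LINT u:{0..<1}|lborel. f (a * (u + real i))))" for n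
  proof (induction n)
    case (Suc n)
    have "(LINT x:{real n * a..<real n * a + a}|lborel. f x) = a * (LINT u:{0..<1}|lborel. f (a * (u + real n)))"
      by (subst set_integral_affine[OF a(1)]) (simp add: algebra_simps)
    then show ?case using Suc join[of "real n * a" "real n * a + a"] a by (simp add: algebra_simps)
  qed (simp add: set_lebesgue_integral_def)
  moreover have "(LINT x:{real M * a..<1}|lborel. f x)
      = (1 - real M * a) * (LINT u:{0..<1}|lborel. f (real M * a + (1 - real M * a) * u))"
  proof (cases "real M * a = 1")
    case False
    then have "0 < 1 - real M * a" using a by simp
    from set_integral_affine[OF this, of "real M * a" f] show ?thesis by simp
  qed (simp add: set_lebesgue_integral_def)
  ultimately show ?thesis using join[of "real M * a" 1] a by simp
qed

lemma set_integral_fubini: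
  fixes G :: "real \<times> real \<Rightarrow> real"
  assumes G: "G \<in> borel_measurable borel" "\<And>x. \<bar>G x\<bar> \<le> K"
  shows "(LINT x:half_open_square|lborel. G x) = (LINT u:{0..<1}|lborel. LINT c:{0..<1}|lborel. G (u, c))"
proof -
  have hs: "half_open_square \<in> sets borel"
    unfolding half_open_square_def borel_prod[symmetric] by simp
  have "bounded half_open_square" by (simp add: half_open_square_def bounded_Times)
  then have "set_integrable lborel half_open_square G"
    using G hs by (intro set_integrable_bounded) auto
  then have "integrable (lborel \<Otimes>\<^sub>M lborel) (\<lambda>x. indicat_real half_open_square x *\<^sub>R G x)"
    by (simp add: set_integrable_def lborel_prod)
  from lborel_pair.integral_fst'[OF this]
  have "(LINT x:half_open_square|lborel. G x) =
    (\<integral>u. \<integral>c. indicat_real half_open_square (u, c) *\<^sub>R G (u, c) \<partial>lborel \<partial>lborel)"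
    by (simp add: set_lebesgue_integral_def lborel_prod)
  also have "\<dots> = (LINT u:{0..<1}|lborel. LINT c:{0..<1}|lborel. G (u, c))"
    by (simp add: set_lebesgue_integral_def half_open_square_def indicator_times mult.assoc)
  finally show ?thesis .
qed

lemma borel_measurable_pre [measurable]:
  "alpha_pre M a \<in> borel_measurable borel" "beta_pre M a i \<in> borel_measurable borel"
  unfolding alpha_pre_def beta_pre_def borel_prod[symmetric] by measurable

text \<open>Let g be the integral of G over a central fibre. Splitting fibres by the first digit
  turns the \<alpha>-term into integrals of g over the M strips; reassembling fibres from their M
  pieces turns the \<beta>-terms into the integral of g over the rest.
  \<open>set_integral_step\<close> glues these together.\<close>

lemma set_integral_transfer:
  assumes G[measurable]: "G \<in> borel_measurable borel" and K: "\<And>x. \<bar>G x\<bar> \<le> K"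
    and a: "0 < a" "real M * a < 1" and M: "M \<ge> 1"
  shows "(LINT x:half_open_square|lborel. transfer M a G x) = (LINT x:half_open_square|lborel. G x)"
proof -
  have [measurable]: "G \<in> borel_measurable (borel \<Otimes>\<^sub>M borel)" by (simp add: borel_prod)
  have hs: "half_open_square \<in> sets borel"
    unfolding half_open_square_def borel_prod[symmetric] by simp
  have fin: "bounded half_open_square" by (simp add: half_open_square_def bounded_Times)
  have si: "set_integrable lborel half_open_square (\<lambda>x. G (f x))" if "f \<in> borel_measurable borel" for f
    using that K hs fin by (intro set_integrable_bounded[where K=K]) simp_all
  have si1: "set_integrable lborel {0..<1} f" if "f \<in> borel_measurable borel" "\<And>x. \<bar>f x\<bar> \<le> K"
    for f :: "real \<Rightarrow> real"
    using that by (intro set_integrable_bounded) auto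
  define g where "g u = (LINT c:{0..<1}|lborel. G (u, c))" for u
  have g[measurable]: "g \<in> borel_measurable borel"
    unfolding g_def set_lebesgue_integral_def by measurable
  have gK: "\<bar>g u\<bar> \<le> K" for u
    unfolding g_def using K by (intro unit_integral_bound) auto
  have step: "(LINT c:{0..<1}|lborel. f c) = (\<Sum>i<M. (LINT c:{0..<1}|lborel. f ((c + real i) / real M)) / real M)"
    if f: "f \<in> borel_measurable borel" "\<And>x. \<bar>f x\<bar> \<le> K" for f :: "real \<Rightarrow> real"
    using set_integral_step[OF f, of "1 / real M" M] M by simp
  have alpha: "(LINT x:half_open_square|lborel. G (alpha_pre M a x))
      = (\<Sum>j<M. (LINT u:{0..<1}|lborel. g (a * (u + real j)))) / real M"
  proof -
    \<comment> \<open>On the j-th piece of a fibre the first digit is j, so \<open>alpha_pre\<close>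
      is affine there.\<close>
    have fl: "\<lfloor>c + real j\<rfloor> = int j" if "c \<in> {0..<1}" for c j
      using that by (simp add: floor_eq_iff)
    have "(LINT c:{0..<1}|lborel. G (alpha_pre M a (u, c))) = (\<Sum>j<M. g (a * (u + real j)) / real M)" for u
      using M K fl by (subst step) (auto simp: g_def alpha_pre_def intro!: sum.cong set_lebesgue_integral_cong)
    moreover have "(\<lambda>x. G (alpha_pre M a x)) \<in> borel_measurable borel" by measurable
    ultimately have "(LINT x:half_open_square|lborel. G (alpha_pre M a x))
      = (LINT u:{0..<1}|lborel. (\<Sum>j<M. g (a * (u + real j)) / real M))"
      using K by (subst set_integral_fubini[where K=K]) auto
    also have "\<dots> = (\<Sum>j<M. (LINT u:{0..<1}|lborel. g (a * (u + real j)) / real M))"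
      using gK by (intro set_integral_sum(1) set_integrable_divide si1) auto
    finally show ?thesis by (simp add: sum_divide_distrib)
  qed
  have "(\<Sum>i<M. LINT x:half_open_square|lborel. G (beta_pre M a i x))
      = real M * (LINT u:{0..<1}|lborel. g (real M * a + (1 - real M * a) * u))"
  proof -
    have "(LINT x:half_open_square|lborel. G (beta_pre M a i x)) =
       (LINT u:{0..<1}|lborel. LINT c:{0..<1}|lborel. G (real M * a + (1 - real M * a) * u, (c + real i) / real M))" for i
      using K measurable_compose[OF borel_measurable_pre(2)[of M a i] G]
      by (subst set_integral_fubini[where K=K]) (simp_all add: beta_pre_def)
    then have "(\<Sum>i<M. LINT x:half_open_square|lborel. G (beta_pre M a i x)) =
       (LINT u:{0..<1}|lborel. \<Sum>i<M. LINT c:{0..<1}|lborel. G (real M * a + (1 - real M * a) * u, (c + real i) / real M))"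
    proof (simp, intro set_integral_sum(1)[symmetric])
      fix i
      show "set_integrable lborel {0..<1} (\<lambda>u. LINT c:{0..<1}|lborel. G (real M * a + (1 - real M * a) * u, (c + real i) / real M))"
      proof (intro si1)
        show "(\<lambda>u. LINT c:{0..<1}|lborel. G (real M * a + (1 - real M * a) * u, (c + real i) / real M)) \<in> borel_measurable borel"
          unfolding set_lebesgue_integral_def by measurable
      qed (intro unit_integral_bound K; measurable)
    qed
    also have "(\<lambda>u. \<Sum>i<M. LINT c:{0..<1}|lborel. G (real M * a + (1 - real M * a) * u, (c + real i) / real M))
      = (\<lambda>u. real M * g (real M * a + (1 - real M * a) * u))"
    proof
      fix u
      show "(\<Sum>i<M. LINT c:{0..<1}|lborel. G (real M * a + (1 - real M * a) * u, (c + real i) / real M))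
        = real M * g (real M * a + (1 - real M * a) * u)"
        unfolding g_def using K M
        by (subst step[of "\<lambda>c. G (real M * a + (1 - real M * a) * u, c)"]) (auto simp flip: sum_divide_distrib)
    qed
    finally show ?thesis by simp
  qed
  then have beta: "(1 - real M * a) / real M * (\<Sum>i<M. LINT x:half_open_square|lborel. G (beta_pre M a i x))
      = (1 - real M * a) * (LINT u:{0..<1}|lborel. g (real M * a + (1 - real M * a) * u))" using M by simp
  have "(LINT x:half_open_square|lborel. transfer M a G x) =
      real M * a * (LINT x:half_open_square|lborel. G (alpha_pre M a x))
      + (1 - real M * a) / real M * (\<Sum>i<M. LINT x:half_open_square|lborel. G (beta_pre M a i x))"
    unfolding transfer_def
    by (subst set_integral_add) (auto intro!: si set_integrable_mult_right set_integral_sum(2) simp: set_integral_sum(1) si)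
  also have "\<dots> = (\<Sum>j<M. a * (LINT u:{0..<1}|lborel. g (a * (u + real j))))
      + (1 - real M * a) * (LINT u:{0..<1}|lborel. g (real M * a + (1 - real M * a) * u))"
    unfolding beta alpha using M by (simp flip: sum_distrib_left)
  also have "\<dots> = (LINT u:{0..<1}|lborel. g u)"
    by (rule set_integral_step[OF g gK a(1) less_imp_le[OF a(2)], symmetric])
  also have "\<dots> = (LINT x:half_open_square|lborel. G x)"
    unfolding g_def by (rule set_integral_fubini[OF G K, symmetric])
  finally show ?thesis .
qed

subsection \<open>Loss of memory\<close>

text \<open>The inverse branches are exact on this square; \<open>integral_leb_square\<close> leads
  back to the closed one.\<close>

definition leb_half_open :: "(real \<times> real) measure" where
  "leb_half_open = restrict_space lborel half_open_square"

lemma half_open_square_borel [measurable]: "half_open_square \<in> sets borel"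
  unfolding half_open_square_def borel_prod[symmetric] by simp

lemma space_leb_half_open [simp]: "space leb_half_open = half_open_square"
  by (simp add: leb_half_open_def)

lemma integral_leb_half_open:
  "integral\<^sup>L leb_half_open f = (LINT x:half_open_square|lborel. f x)"
  for f :: "real \<times> real \<Rightarrow> real"
  unfolding leb_half_open_def by (simp add: integral_restrict_space set_lebesgue_integral_def)

interpretation leb_half_open: prob_space leb_half_open
proof
  have "emeasure lborel half_open_square = 1"
    unfolding half_open_square_def lborel_prod[symmetric]
    by (subst lborel.emeasure_pair_measure_Times) auto
  then show "emeasure leb_half_open (space leb_half_open) = 1"
    by (simp add: leb_half_open_def emeasure_restrict_space)
qed

lemma (in prob_space) integrable_bounded:
  fixes f :: "'a \<Rightarrow> real"
  assumes "f \<in> borel_measurable M" "\<And>x. x \<in> space M \<Longrightarrow> \<bar>f x\<bar> \<le> K"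
  shows "integrable M f"
  using assms by (intro integrable_const_bound[of f K]) auto

lemma (in prob_space) integral_bounded:
  fixes f :: "'a \<Rightarrow> real"
  assumes f: "f \<in> borel_measurable M" and K: "\<And>x. x \<in> space M \<Longrightarrow> \<bar>f x\<bar> \<le> K"
  shows "\<bar>integral\<^sup>L M f\<bar> \<le> K"
proof -
  have i: "integrable M f" using assms by (rule integrable_bounded)
  have "integral\<^sup>L M f \<le> K" using K by (intro integral_le_const i AE_I2) (simp add: abs_le_iff)
  moreover have "- K \<le> integral\<^sup>L M f"
  proof (intro integral_ge_const i AE_I2)
    fix x assume "x \<in> space M"
    from K[OF this] show "- K \<le> f x" by linarith
  qed
  ultimately show ?thesis by linarith
qed

lemma (in prob_space) integral_diff_bound:
  fixes f g :: "'a \<Rightarrow> real"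
  assumes "integrable M f" "integrable M g" "\<And>x. x \<in> space M \<Longrightarrow> \<bar>f x - g x\<bar> \<le> e"
  shows "\<bar>integral\<^sup>L M f - integral\<^sup>L M g\<bar> \<le> e"
  using integral_bounded[of "\<lambda>x. f x - g x" e] assms by simp

text \<open>Only preimages of x enter. Recording \<open>baker M a w = x\<close> allows a function of
  the image to be replaced by its value at x.\<close>

lemma transfer_cong:
  assumes a: "0 < a" "real M * a < 1" and M: "M \<ge> 1" and x: "x \<in> half_open_square"
    and "\<And>w. w \<in> half_open_square \<Longrightarrow> baker M a w = x \<Longrightarrow> G w = G' w"
  shows "transfer M a G x = transfer M a G' x"
  unfolding transfer_def
  using alpha_pre_props[OF a M x] beta_pre_props[OF a _ x] assms(5) by (intro arg_cong2[where f="(+)"]) simp_all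

text \<open>The bound S is required only for preimages of x and y, so quantities that depend on the
  images alone count as constants.\<close>

lemma transfer_diff_bound:
  assumes a: "0 < a" "real M * a < 1" and M: "M \<ge> 1"
    and x: "x \<in> half_open_square" and y: "y \<in> half_open_square"
    and S: "\<And>v w. v \<in> half_open_square \<Longrightarrow> w \<in> half_open_square \<Longrightarrow> baker M a v = x \<Longrightarrow> baker M a w = y
      \<Longrightarrow> \<bar>G v - G w\<bar> \<le> S v w"
  shows "\<bar>transfer M a G x - transfer M a G y\<bar> \<le> coupled_transfer M a S x y"
proof -
  have 1: "\<bar>real M * a * (G (alpha_pre M a x) - G (alpha_pre M a y))\<bar>
      \<le> real M * a * S (alpha_pre M a x) (alpha_pre M a y)"
    using a alpha_pre_props[OF a M x] alpha_pre_props[OF a M y]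
    by (auto simp: abs_mult intro!: mult_left_mono S)
  have "\<bar>\<Sum>i<M. G (beta_pre M a i x) - G (beta_pre M a i y)\<bar> \<le> (\<Sum>i<M. S (beta_pre M a i x) (beta_pre M a i y))"
    using beta_pre_props[OF a _ x] beta_pre_props[OF a _ y]
    by (intro order_trans[OF sum_abs] sum_mono S) auto
  then have 2: "\<bar>(1 - real M * a) / real M * (\<Sum>i<M. G (beta_pre M a i x) - G (beta_pre M a i y))\<bar>
      \<le> (1 - real M * a) / real M * (\<Sum>i<M. S (beta_pre M a i x) (beta_pre M a i y))"
    using a by (simp add: abs_mult mult_left_mono divide_right_mono)
  have eq: "transfer M a G x - transfer M a G y = real M * a * (G (alpha_pre M a x) - G (alpha_pre M a y))
     + (1 - real M * a) / real M * (\<Sum>i<M. G (beta_pre M a i x) - G (beta_pre M a i y))"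
    by (simp add: transfer_def sum_subtractf right_diff_distrib)
  show ?thesis unfolding eq coupled_transfer_def by (rule order_trans[OF abs_triangle_ineq add_mono[OF 1 2]])
qed

lemma transfer_bound:
  assumes a: "0 < a" "real M * a < 1" and M: "M \<ge> 1"
    and x: "x \<in> half_open_square"
    and K: "\<And>w. w \<in> half_open_square \<Longrightarrow> \<bar>G w\<bar> \<le> K"
  shows "\<bar>transfer M a G x\<bar> \<le> K"
proof -
  have 1: "\<bar>real M * a * G (alpha_pre M a x)\<bar> \<le> real M * a * K"
    using a K[OF alpha_pre_props(1)[OF a M x]] by (simp add: abs_mult mult_left_mono)
  have "\<bar>\<Sum>i<M. G (beta_pre M a i x)\<bar> \<le> (\<Sum>i<M. K)"
    using beta_pre_props[OF a _ x] K by (intro order_trans[OF sum_abs] sum_mono) auto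
  moreover have c: "0 \<le> (1 - real M * a) / real M" using a by simp
  ultimately have "\<bar>(1 - real M * a) / real M * (\<Sum>i<M. G (beta_pre M a i x))\<bar> \<le> (1 - real M * a) / real M * (\<Sum>i<M. K)"
    unfolding abs_mult abs_of_nonneg[OF c] by (intro mult_left_mono)
  also have "\<dots> = (1 - real M * a) * K" using M by simp
  finally have "\<bar>transfer M a G x\<bar> \<le> real M * a * K + (1 - real M * a) * K"
    unfolding transfer_def by (intro order_trans[OF abs_triangle_ineq add_mono] 1)
  then show ?thesis by (simp add: algebra_simps)
qed

lemma transfer_measurable:
  assumes a: "0 < a" "real M * a < 1" and M: "M \<ge> 1" and G: "G \<in> borel_measurable leb_half_open"
  shows "transfer M a G \<in> borel_measurable leb_half_open"
proof -
  have "alpha_pre M a \<in> measurable leb_half_open leb_half_open"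
    using alpha_pre_props(1)[OF a M] unfolding leb_half_open_def
    by (intro measurable_restrict_space2 measurable_restrict_space1) auto
  moreover have "beta_pre M a i \<in> measurable leb_half_open leb_half_open" if "i < M" for i
    using beta_pre_props(1)[OF a that] unfolding leb_half_open_def
    by (intro measurable_restrict_space2 measurable_restrict_space1) auto
  ultimately show ?thesis
    unfolding transfer_def
    by (intro borel_measurable_add borel_measurable_times borel_measurable_const borel_measurable_sum)
      (auto intro: measurable_compose[OF _ G])
qed

lemma integral_transfer:
  assumes a: "0 < a" "real M * a < 1" and M: "M \<ge> 1" and G: "G \<in> borel_measurable leb_half_open"
    and K: "\<And>x. x \<in> half_open_square \<Longrightarrow> \<bar>G x\<bar> \<le> K"
  shows "integral\<^sup>L leb_half_open (transfer M a G) = integral\<^sup>L leb_half_open G"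
proof -
  \<comment> \<open>Extension by 0 gives the globally bounded Borel function that
    \<open>set_integral_transfer\<close> asks for. The values at preimages are unaffected, since
    these stay in the half-open square.\<close>
  define G' where "G' x = indicat_real half_open_square x *\<^sub>R G x" for x
  have "(0, 0) \<in> half_open_square" by (simp add: half_open_square_def)
  from K[OF this] have "0 \<le> K" by linarith
  then have K': "\<bar>G' x\<bar> \<le> K" for x using K by (simp add: G'_def indicator_def)
  have G': "G' \<in> borel_measurable borel"
    using G unfolding G'_def leb_half_open_def by (simp add: borel_measurable_restrict_space_iff)
  have eq: "G' x = G x" if "x \<in> half_open_square" for x using that by (simp add: G'_def)
  have "integral\<^sup>L leb_half_open (transfer M a G) = integral\<^sup>L leb_half_open (transfer M a G')"
    using eq by (intro Bochner_Integration.integral_cong refl transfer_cong[OF a M]) auto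
  also have "\<dots> = integral\<^sup>L leb_half_open G'"
    unfolding integral_leb_half_open by (rule set_integral_transfer[OF G' K' a M])
  also have "\<dots> = integral\<^sup>L leb_half_open G"
    using eq by (intro Bochner_Integration.integral_cong) auto
  finally show ?thesis .
qed

text \<open>The transfer operator of the n-fold composition: the last map, with parameter
  \<open>a n\<close>, acts outermost.\<close>

primrec transfer_iter :: "nat \<Rightarrow> (nat \<Rightarrow> real) \<Rightarrow> nat \<Rightarrow> (real \<times> real \<Rightarrow> real) \<Rightarrow> real \<times> real \<Rightarrow> real" where
  "transfer_iter M a 0 G = G"
| "transfer_iter M a (Suc n) G = transfer M (a (Suc n)) (transfer_iter M a n G)"

lemma baker_comp_empty: "baker_comp M a (Suc n) n x = x"
  by (simp add: baker_comp_def)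

lemma baker_comp_Suc: "baker_comp M a 1 (Suc n) x = baker M (a (Suc n)) (baker_comp M a 1 n x)"
  by (simp add: baker_comp_def)

lemma baker_comp_rec:
  "k \<le> j \<Longrightarrow> baker_comp M a k j x = baker_comp M a (Suc k) j (baker M (a k) x)"
  by (simp add: baker_comp_def upt_conv_Cons del: upt_Suc)

lemma baker_comp_split:
  assumes "k \<le> j"
  shows "baker_comp M a 1 j x = baker_comp M a (Suc k) j (baker_comp M a 1 k x)"
proof -
  have "[1..<Suc j] = [1..<Suc k] @ [Suc k..<Suc j]"
    using upt_add_eq_append[of 1 "Suc k" "j - k"] assms by simp
  then show ?thesis by (simp add: baker_comp_def)
qed

locale baker_seq =
  fixes M :: nat and a :: "nat \<Rightarrow> real"
  assumes M: "M \<ge> 1" and a: "\<And>k. k \<ge> 1 \<Longrightarrow> 0 < a k" "\<And>k. k \<ge> 1 \<Longrightarrow> real M * a k < 1"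
begin

lemma baker_comp_invariant:
  assumes "\<And>j x. j \<ge> 1 \<Longrightarrow> x \<in> S \<Longrightarrow> baker M (a j) x \<in> S" and "k \<ge> 1" "x \<in> S"
  shows "baker_comp M a k l x \<in> S"
proof -
  have "fold (\<lambda>j. baker M (a j)) js y \<in> S" if "\<forall>j\<in>set js. j \<ge> 1" "y \<in> S" for js y
    using that
  proof (induction js arbitrary: y)
    case (Cons j js)
    then show ?case using assms(1)[of j y] by simp
  qed simp
  then show ?thesis using assms(2,3) by (simp add: baker_comp_def del: upt_Suc)
qed

lemma baker_comp_in_square:
  "k \<ge> 1 \<Longrightarrow> x \<in> square \<Longrightarrow> baker_comp M a k l x \<in> square"
  using baker_comp_invariant[of square] baker_in_square[OF a M] by blast

lemma baker_comp_in_half_open_square: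
  "k \<ge> 1 \<Longrightarrow> x \<in> half_open_square \<Longrightarrow> baker_comp M a k l x \<in> half_open_square"
  using baker_comp_invariant[of half_open_square] baker_in_half_open_square[OF a M] by blast

lemma baker_measurable_restrict:
  assumes j: "j \<ge> 1" and S: "S \<subseteq> square" "\<And>x. x \<in> S \<Longrightarrow> baker M (a j) x \<in> S"
  shows "baker M (a j) \<in> measurable (restrict_space lborel S) (restrict_space lborel S)"
proof (rule measurable_restrict_space2)
  let ?f = "\<lambda>x. if fst x < real M * a j
     then (fst x / a j - of_int \<lfloor>fst x / a j\<rfloor>, (snd x + of_int \<lfloor>fst x / a j\<rfloor>) / real M)
     else ((fst x - real M * a j) / (1 - real M * a j),
           real M * snd x - of_int (min \<lfloor>real M * snd x\<rfloor> (int M - 1)))"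
  have "?f \<in> borel_measurable borel" unfolding borel_prod[symmetric] by measurable
  then have "?f \<in> measurable (restrict_space lborel S) lborel" by (intro measurable_restrict_space1) simp
  then show "baker M (a j) \<in> measurable (restrict_space lborel S) lborel"
    by (rule measurable_cong[THEN iffD1, rotated])
      (use S baker_eq[OF a(1)[OF j] a(2)[OF j] M] in \<open>auto simp: space_restrict_space\<close>)
qed (use S in \<open>auto simp: space_restrict_space\<close>)

lemma baker_comp_measurable_restrict:
  assumes S: "S \<subseteq> square" "\<And>j x. j \<ge> 1 \<Longrightarrow> x \<in> S \<Longrightarrow> baker M (a j) x \<in> S" and k: "k \<ge> 1"
  shows "baker_comp M a k l \<in> measurable (restrict_space lborel S) (restrict_space lborel S)"
proof -
  have "fold (\<lambda>j. baker M (a j)) js \<in> measurable (restrict_space lborel S) (restrict_space lborel S)"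
    if "\<forall>j\<in>set js. j \<ge> 1" for js
    using that by (induction js) (auto simp: id_def intro!: measurable_comp baker_measurable_restrict S)
  then show ?thesis using k by (simp add: baker_comp_def del: upt_Suc)
qed

lemma baker_comp_measurable_square:
  "k \<ge> 1 \<Longrightarrow> baker_comp M a k l \<in> measurable leb_square leb_square"
  unfolding leb_square_def
  by (rule baker_comp_measurable_restrict) (use baker_in_square[OF a M] in blast)+

lemma baker_comp_measurable_half_open:
  "k \<ge> 1 \<Longrightarrow> baker_comp M a k l \<in> measurable leb_half_open leb_half_open"
  unfolding leb_half_open_def
  by (rule baker_comp_measurable_restrict)
    (use half_open_square_subset baker_in_half_open_square[OF a M] in blast)+

lemma transfer_iter_bound:
  assumes "\<And>w. w \<in> half_open_square \<Longrightarrow> \<bar>G w\<bar> \<le> K" and "x \<in> half_open_square"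
  shows "\<bar>transfer_iter M a n G x\<bar> \<le> K"
  using assms(2) by (induction n arbitrary: x) (auto intro!: transfer_bound M a assms(1))

lemma transfer_iter_measurable:
  assumes "G \<in> borel_measurable leb_half_open"
  shows "transfer_iter M a n G \<in> borel_measurable leb_half_open"
  by (induction n) (auto intro!: transfer_measurable M a assms)

lemma integral_transfer_iter:
  assumes G: "G \<in> borel_measurable leb_half_open"
    and K: "\<And>x. x \<in> half_open_square \<Longrightarrow> \<bar>G x\<bar> \<le> K"
  shows "integral\<^sup>L leb_half_open (transfer_iter M a n G) = integral\<^sup>L leb_half_open G"
proof (induction n)
  case (Suc n)
  have "integral\<^sup>L leb_half_open (transfer_iter M a (Suc n) G) = integral\<^sup>L leb_half_open (transfer_iter M a n G)"
    unfolding transfer_iter.simps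
    by (intro integral_transfer transfer_iter_measurable G M a) (auto intro: transfer_iter_bound K)
  then show ?case using Suc by simp
qed simp

text \<open>The iterate at z averages over points whose n-fold image is z, so the second argument of
  f is constantly z. The induction absorbs the last map into that argument, hence f is
  arbitrary.\<close>

lemma transfer_iter_graph:
  "z \<in> half_open_square \<Longrightarrow>
    transfer_iter M a n (\<lambda>x. f x (baker_comp M a 1 n x)) z = transfer_iter M a n (\<lambda>x. f x z) z"
proof (induction n arbitrary: f z)
  case 0
  then show ?case by (simp add: baker_comp_empty[of M a 0, simplified])
next
  case (Suc n)
  show ?case unfolding transfer_iter.simps
  proof (rule transfer_cong)
    fix w assume w: "w \<in> half_open_square" "baker M (a (Suc n)) w = z"
    show "transfer_iter M a n (\<lambda>x. f x (baker_comp M a 1 (Suc n) x)) w = transfer_iter M a n (\<lambda>x. f x z) w"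
      using Suc.IH[OF w(1), of "\<lambda>x y. f x (baker M (a (Suc n)) y)"] w(2)
      by (simp only: baker_comp_Suc)
  qed (use a M Suc.prems in auto)
qed

end

section \<open>Exponential contraction along a sequence of baker maps\<close>

locale coupled_baker_seq = coupling +
  fixes a :: "nat \<Rightarrow> real"
  assumes a_bounds: "\<And>k. k \<ge> 1 \<Longrightarrow> a_low \<le> a k" "\<And>k. k \<ge> 1 \<Longrightarrow> a k \<le> a_up"
begin

sublocale baker_seq M a
proof
  fix k :: nat assume k: "k \<ge> 1"
  show "0 < a k" using a_bounds(1)[OF k] a_low by linarith
  have "a k < 1 / (2 * real M)" using a_bounds(2)[OF k] a_up by linarith
  then show "real M * a k < 1" using M by (simp add: field_simps)
qed (rule M)

lemma lam_nonneg: "0 \<le> lam"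
  using lam(2) powr_ge_zero order_trans by blast

text \<open>Each backward step takes the term \<open>j = n\<close> out of the sum, adds it to the
  current multiple of \<open>V\<close> and contracts the total by \<open>lam\<close>. The later
  terms depend only on the images and pass through as a constant.\<close>

lemma transfer_iter_contraction:
  assumes A: "0 \<le> A"
    and G: "\<And>x y. x \<in> half_open_square \<Longrightarrow> y \<in> half_open_square \<Longrightarrow>
      \<bar>G x - G y\<bar> \<le> A * (\<Sum>j\<le>N. V (baker_comp M a 1 j x) (baker_comp M a 1 j y))"
    and n: "n \<le> Suc N" and xy: "x \<in> half_open_square" "y \<in> half_open_square"
  shows "\<bar>transfer_iter M a n G x - transfer_iter M a n G y\<bar> \<le>
    A * lam / (1 - lam) * V x y
    + A * (\<Sum>j=n..N. V (baker_comp M a (Suc n) j x) (baker_comp M a (Suc n) j y))"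
  using n xy
proof (induction n arbitrary: x y)
  case 0
  have "0 \<le> A * lam / (1 - lam) * V x y"
    using A lam lam_nonneg V_bounds[OF 0(2,3)] by (intro mult_nonneg_nonneg divide_nonneg_nonneg) auto
  then show ?case using G[OF 0(2,3)] by (simp add: atLeast0AtMost)
next
  case (Suc n)
  define b where "b = a (Suc n)"
  \<comment> \<open>B is the fixed point of adding A and then contracting:
    \<open>(B + A) * lam = B\<close>.\<close>
  define B where "B = A * lam / (1 - lam)"
  define R where "R = A * (\<Sum>j=Suc n..N. V (baker_comp M a (Suc (Suc n)) j x) (baker_comp M a (Suc (Suc n)) j y))"
  have b: "0 < b" "real M * b < 1" "a_low \<le> b" "b \<le> a_up" using a a_bounds by (auto simp: b_def)
  have B: "0 \<le> B" "(B + A) * lam = B"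
    using A lam lam_nonneg by (auto simp: B_def field_simps)
  have "\<bar>transfer_iter M a n G v - transfer_iter M a n G w\<bar> \<le> (B + A) * V v w + R"
    if vw: "v \<in> half_open_square" "w \<in> half_open_square" "baker M b v = x" "baker M b w = y" for v w
  proof -
    have "(\<Sum>j=n..N. V (baker_comp M a (Suc n) j v) (baker_comp M a (Suc n) j w))
      = V v w + (\<Sum>j=Suc n..N. V (baker_comp M a (Suc n) j v) (baker_comp M a (Suc n) j w))"
      using Suc.prems(1) by (subst sum.atLeast_Suc_atMost) (auto simp: baker_comp_empty)
    also have "(\<Sum>j=Suc n..N. V (baker_comp M a (Suc n) j v) (baker_comp M a (Suc n) j w))
      = (\<Sum>j=Suc n..N. V (baker_comp M a (Suc (Suc n)) j x) (baker_comp M a (Suc (Suc n)) j y))"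
      using vw(3,4) by (intro sum.cong) (auto simp: baker_comp_rec[of "Suc n"] b_def)
    finally show ?thesis
      using Suc.IH[OF _ vw(1,2)] Suc.prems(1) by (simp add: B_def R_def algebra_simps)
  qed
  from transfer_diff_bound[OF b(1,2) M Suc.prems(2,3) this]
  have "\<bar>transfer M b (transfer_iter M a n G) x - transfer M b (transfer_iter M a n G) y\<bar>
    \<le> (B + A) * coupled_transfer M b V x y + R"
    unfolding coupled_transfer_affine[OF M] .
  also have "\<dots> \<le> (B + A) * (lam * V x y) + R"
    using A B by (intro add_right_mono mult_left_mono coupling_contraction b Suc.prems) auto
  also have "(B + A) * (lam * V x y) = B * V x y" using B(2) by (simp flip: mult.assoc)
  finally show ?case by (simp add: b_def B_def R_def)
qed

text \<open>After \<open>Suc N\<close> steps the sum over orbit times is empty, and each further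
  step gains a factor \<open>lam\<close>.\<close>

lemma transfer_iter_contraction_later:
  assumes A: "0 \<le> A"
    and G: "\<And>x y. x \<in> half_open_square \<Longrightarrow> y \<in> half_open_square \<Longrightarrow>
      \<bar>G x - G y\<bar> \<le> A * (\<Sum>j\<le>N. V (baker_comp M a 1 j x) (baker_comp M a 1 j y))"
    and xy: "x \<in> half_open_square" "y \<in> half_open_square"
  shows "\<bar>transfer_iter M a (Suc N + m) G x - transfer_iter M a (Suc N + m) G y\<bar> \<le>
    A * lam / (1 - lam) * lam ^ m * V x y"
  using xy
proof (induction m arbitrary: x y)
  case 0
  then show ?case using transfer_iter_contraction[OF A G order.refl 0] by simp
next
  case (Suc m)
  define b where "b = a (Suc (Suc N + m))"
  have b: "0 < b" "real M * b < 1" "a_low \<le> b" "b \<le> a_up" using a a_bounds by (auto simp: b_def)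
  define B where "B = A * lam / (1 - lam) * lam ^ m"
  have B: "0 \<le> B" using A lam lam_nonneg by (auto simp: B_def)
  have "\<bar>transfer M b (transfer_iter M a (Suc N + m) G) x - transfer M b (transfer_iter M a (Suc N + m) G) y\<bar>
    \<le> coupled_transfer M b (\<lambda>v w. B * V v w + 0) x y"
    unfolding B_def by (rule transfer_diff_bound[OF b(1,2) M Suc.prems]) (use Suc.IH in simp)
  also have "\<dots> = B * coupled_transfer M b V x y" unfolding coupled_transfer_affine[OF M] by simp
  also have "\<dots> \<le> B * (lam * V x y)"
    using B by (intro mult_left_mono coupling_contraction b Suc.prems) auto
  finally show ?case by (simp add: b_def B_def algebra_simps)
qed

text \<open>Let \<open>P z\<close> be the k-th iterate of \<open>f(., z)\<close>. By invariance and
  the graph identity the first integral is the mean of \<open>P z z\<close>; by invariance again the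
  inner integral of the second is the mean of \<open>P z\<close>. The oscillation of
  \<open>P z\<close> is at most e, where the factor \<open>1 / r\<close> comes from the bound on
  \<open>V\<close>.\<close>

lemma decorrelation:
  fixes f :: "(real \<times> real) \<times> (real \<times> real) \<Rightarrow> real"
  assumes f[measurable]: "f \<in> borel_measurable (leb_half_open \<Otimes>\<^sub>M leb_half_open)"
    and K: "\<And>x z. x \<in> half_open_square \<Longrightarrow> z \<in> half_open_square \<Longrightarrow> \<bar>f (x, z)\<bar> \<le> K"
    and A: "0 \<le> A"
    and osc: "\<And>x y z. x \<in> half_open_square \<Longrightarrow> y \<in> half_open_square \<Longrightarrow> z \<in> half_open_square \<Longrightarrow>
      \<bar>f (x, z) - f (y, z)\<bar> \<le> A * (\<Sum>j\<le>N. V (baker_comp M a 1 j x) (baker_comp M a 1 j y))"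
    and k: "N < k"
  shows "\<bar>(LINT x|leb_half_open. f (x, baker_comp M a 1 k x)) - (LINT z|leb_half_open. LINT x|leb_half_open. f (x, z))\<bar>
    \<le> A * lam / (1 - lam) / r * lam ^ (k - Suc N)"
proof -
  define e where "e = A * lam / (1 - lam) / r * lam ^ (k - Suc N)"
  define g where "g x = f (x, baker_comp M a 1 k x)" for x
  define P where "P z x = transfer_iter M a k (\<lambda>x. f (x, z)) x" for z x
  have [measurable]: "baker_comp M a 1 k \<in> measurable leb_half_open leb_half_open"
    by (rule baker_comp_measurable_half_open) simp
  have g[measurable]: "g \<in> borel_measurable leb_half_open" unfolding g_def by measurable
  have gK: "\<bar>g x\<bar> \<le> K" if "x \<in> half_open_square" for x
    using that unfolding g_def by (intro K baker_comp_in_half_open_square) auto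
  have diag: "transfer_iter M a k g z = P z z" if "z \<in> half_open_square" for z
    using transfer_iter_graph[OF that, of k "\<lambda>x z. f (x, z)"] by (simp add: g_def[abs_def] P_def)
  have fz: "(\<lambda>x. f (x, z)) \<in> borel_measurable leb_half_open" if "z \<in> half_open_square" for z
    using that by (intro measurable_compose[OF measurable_Pair2' f]) simp
  have P_osc: "\<bar>P z x - P z y\<bar> \<le> e" if "x \<in> half_open_square" "y \<in> half_open_square" "z \<in> half_open_square" for x y z
  proof -
    have "\<bar>P z x - P z y\<bar> \<le> A * lam / (1 - lam) * lam ^ (k - Suc N) * V x y"
      using transfer_iter_contraction_later[OF A osc[OF _ _ that(3)] that(1,2), where m = "k - Suc N"] k
      by (simp add: P_def)
    also have "\<dots> \<le> A * lam / (1 - lam) * lam ^ (k - Suc N) * (1 / r)"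
      using A lam lam_nonneg V_bounds[OF that(1,2)] by (intro mult_left_mono) auto
    finally show ?thesis by (simp add: e_def)
  qed
  have mean: "\<bar>transfer_iter M a k g z - (LINT x|leb_half_open. f (x, z))\<bar> \<le> e" if z: "z \<in> half_open_square" for z
  proof -
    have "(LINT x|leb_half_open. f (x, z)) = (LINT x|leb_half_open. P z x)"
      unfolding P_def using K z by (intro integral_transfer_iter[where K=K, symmetric] fz) auto
    moreover have "integrable leb_half_open (P z)"
      unfolding P_def using K z
      by (intro leb_half_open.integrable_bounded[where K=K] transfer_iter_measurable fz transfer_iter_bound) auto
    ultimately show ?thesis
      using leb_half_open.integral_diff_bound[of "\<lambda>_. P z z" "P z" e] P_osc z
      leb_half_open.prob_space by (simp add: diag)
  qed
  have "\<bar>(LINT x|leb_half_open. f (x, z))\<bar> \<le> K" if "z \<in> half_open_square" for z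
    using K that by (intro leb_half_open.integral_bounded fz) auto
  then have "integrable leb_half_open (\<lambda>z. LINT x|leb_half_open. f (x, z))"
    by (intro leb_half_open.integrable_bounded) auto
  moreover have "integrable leb_half_open (transfer_iter M a k g)"
    by (intro leb_half_open.integrable_bounded[where K=K] transfer_iter_measurable g transfer_iter_bound) (auto intro: gK)
  ultimately have "\<bar>(LINT z|leb_half_open. transfer_iter M a k g z) - (LINT z|leb_half_open. LINT x|leb_half_open. f (x, z))\<bar> \<le> e"
    using mean by (intro leb_half_open.integral_diff_bound) auto
  moreover have "(LINT z|leb_half_open. transfer_iter M a k g z) = (LINT x|leb_half_open. g x)"
    using gK by (intro integral_transfer_iter[where K=K] g) auto
  ultimately show ?thesis by (simp add: g_def e_def)
qed

end

subsection \<open>Separately Hoelder continuous functions\<close>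

definition sep_holder_on :: "real \<Rightarrow> real \<Rightarrow> nat \<Rightarrow> ((nat \<Rightarrow> real \<times> real) \<Rightarrow> real) \<Rightarrow> bool" where
  "sep_holder_on \<theta> K n F \<longleftrightarrow> (\<forall>x\<in>square_pow n. \<forall>i\<in>{1..n}. \<forall>s\<in>square. \<forall>t\<in>square.
      \<bar>F (x(i := s)) - F (x(i := t))\<bar> \<le> K * dist s t powr \<theta>)"

text \<open>The components are exchanged one at a time; \<open>z m\<close> has already received the
  first m components of y.\<close>

lemma sep_holder_diff:
  assumes F: "sep_holder_on \<theta> K n F" and x: "x \<in> square_pow n" and y: "y \<in> square_pow n"
  shows "\<bar>F x - F y\<bar> \<le> K * (\<Sum>i=1..n. dist (x i) (y i) powr \<theta>)"
proof -
  define z where "z m i = (if i \<le> m then y i else x i)" for m i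
  have ext: "x i = y i" if "i \<notin> {1..n}" for i
    using x y that unfolding square_pow_def by (metis PiE_arb)
  have zm: "z m \<in> square_pow n" for m
    using x y unfolding square_pow_def z_def by (auto simp: PiE_iff extensional_def)
  have "m \<le> n \<Longrightarrow> \<bar>F x - F (z m)\<bar> \<le> K * (\<Sum>i=1..m. dist (x i) (y i) powr \<theta>)" for m
  proof (induction m)
    case 0
    \<comment> \<open>Index 0 lies outside \<open>{1..n}\<close>, where x and y share the default
      value of the extensional product.\<close>
    have "z 0 = x" using ext[of 0] by (auto simp: z_def)
    then show ?case by simp
  next
    case (Suc m)
    have m: "Suc m \<in> {1..n}" using Suc.prems by simp
    have "z (Suc m) = (z m)(Suc m := y (Suc m))" "z m = (z m)(Suc m := x (Suc m))"
      by (auto simp: z_def fun_eq_iff le_Suc_eq)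
    moreover have "x (Suc m) \<in> square" "y (Suc m) \<in> square"
      using x y m unfolding square_pow_def by auto
    ultimately have "\<bar>F (z m) - F (z (Suc m))\<bar> \<le> K * dist (x (Suc m)) (y (Suc m)) powr \<theta>"
      using F zm[of m] m unfolding sep_holder_on_def by metis
    then show ?case using Suc by (simp add: distrib_left)
  qed
  moreover have "z n = y" using ext by (auto simp: z_def fun_eq_iff)
  ultimately show ?thesis by force
qed

text \<open>An infinite norm makes the final bound trivial; otherwise real constants replace the
  extended real norms.\<close>

lemma holder_norm_cases:
  assumes F: "separately_holder \<theta> n F" and n: "n \<ge> 1"
  obtains "holder_norm \<theta> n F = \<infinity>"
  | S K where "0 \<le> S" "0 \<le> K" "holder_norm \<theta> n F = ereal (S + K)"
      "\<And>x. x \<in> square_pow n \<Longrightarrow> \<bar>F x\<bar> \<le> S" "sep_holder_on \<theta> K n F"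
proof (cases "holder_norm \<theta> n F = \<infinity>")
  case False
  define D where "D i = (SUP x\<in>square_pow n. SUP (s, t) \<in> {(s, t). s \<in> square \<and> t \<in> square \<and> s \<noteq> t}.
          ereal (\<bar>F (x(i := s)) - F (x(i := t))\<bar> / dist s t powr \<theta>))" for i
  have sn: "holder_seminorm \<theta> n F = Max (D ` {1..n})" by (simp add: holder_seminorm_def D_def)
  have D: "D i \<le> holder_seminorm \<theta> n F" if "i \<in> {1..n}" for i
    unfolding sn using that by (intro Max_ge) auto
  have quot: "ereal (\<bar>F (x(i := s)) - F (x(i := t))\<bar> / dist s t powr \<theta>) \<le> D i"
    if "x \<in> square_pow n" "s \<in> square" "t \<in> square" "s \<noteq> t" for x s t i
    unfolding D_def by (rule SUP_upper2[OF that(1)], rule SUP_upper2[of "(s, t)"]) (use that in auto)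
  have sq: "(0, 0) \<in> square" "(1, 1) \<in> square" by (auto simp: square_def)
  have x0: "(\<lambda>i\<in>{1..n}. (0, 0)) \<in> square_pow n" using sq by (auto simp: square_pow_def)
  have "0 \<le> D 1"
    by (rule order_trans[OF _ quot[OF x0 sq]]) auto
  then have sn0: "0 \<le> holder_seminorm \<theta> n F" using D[of 1] n by auto
  have up: "ereal \<bar>F x\<bar> \<le> sup_norm n F" if "x \<in> square_pow n" for x
    unfolding sup_norm_def using that by (rule SUP_upper)
  have sup0: "0 \<le> sup_norm n F" by (rule order_trans[OF _ up[OF x0]]) simp
  obtain K where K: "holder_seminorm \<theta> n F = ereal K" "0 \<le> K"
    using sn0 F unfolding separately_holder_def by (cases "holder_seminorm \<theta> n F") auto
  obtain S where S: "sup_norm n F = ereal S" "0 \<le> S"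
    using sup0 False K unfolding holder_norm_def by (cases "sup_norm n F") auto
  have "sep_holder_on \<theta> K n F" unfolding sep_holder_on_def
  proof (intro ballI)
    fix x i s t assume h: "x \<in> square_pow n" "i \<in> {1..n}" "s \<in> square" "t \<in> square"
    show "\<bar>F (x(i := s)) - F (x(i := t))\<bar> \<le> K * dist s t powr \<theta>"
    proof (cases "s = t")
      case False
      with quot[OF h(1,3,4)] D[OF h(2)] have "ereal (\<bar>F (x(i := s)) - F (x(i := t))\<bar> / dist s t powr \<theta>) \<le> ereal K"
        unfolding K by (metis order_trans)
      then show ?thesis using False by (simp add: pos_divide_le_eq)
    qed simp
  qed
  then show ?thesis using up S K that(2)[of S K] by (simp add: holder_norm_def)
qed (rule that(1))

text \<open>Measurability is extracted from the Hoelder bound. Rounding all components to a grid of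
  mesh \<open>1 / Suc m\<close> leaves finitely many argument tuples, and the rounding error tends
  to 0.\<close>

lemma measurable_sep_holder_compose:
  assumes F: "sep_holder_on \<theta> K n F" and \<theta>: "0 < \<theta>" and K: "0 \<le> K"
    and g: "\<And>j. j \<in> {1..n} \<Longrightarrow> g j \<in> borel_measurable N"
    and gsq: "\<And>j x. j \<in> {1..n} \<Longrightarrow> x \<in> space N \<Longrightarrow> g j x \<in> square"
  shows "(\<lambda>x. F (\<lambda>j\<in>{1..n}. g j x)) \<in> borel_measurable N"
proof (rule borel_measurable_LIMSEQ_real)
  define p where "p m x = (of_int \<lfloor>real (Suc m) * fst x\<rfloor> / real (Suc m), of_int \<lfloor>real (Suc m) * snd x\<rfloor> / real (Suc m))"
    for m and x :: "real \<times> real"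
  have p[measurable]: "p m \<in> borel_measurable borel" for m
    unfolding p_def borel_prod[symmetric] by measurable
  have grid: "of_int \<lfloor>real (Suc m) * u\<rfloor> / real (Suc m) \<in> (\<lambda>i. real i / real (Suc m)) ` {..Suc m}"
    if "0 \<le> u" "u \<le> 1" for m u
  proof -
    have "real (Suc m) * u \<le> real (Suc m) * 1" using that by (intro mult_left_mono) auto
    then have "\<lfloor>real (Suc m) * u\<rfloor> \<le> int (Suc m)"
      using floor_mono[of "real (Suc m) * u" "real (Suc m) * 1"] by simp
    moreover have "0 \<le> \<lfloor>real (Suc m) * u\<rfloor>" using that by simp
    ultimately show ?thesis by (intro image_eqI[of _ _ "nat \<lfloor>real (Suc m) * u\<rfloor>"]) auto
  qed
  define A where "A m = (\<lambda>i. real i / real (Suc m)) ` {..Suc m}" for m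
  have pA: "p m x \<in> A m \<times> A m" if "x \<in> square" for m x
    using grid that unfolding p_def A_def by (auto simp: square_def)
  have A_sq: "A m \<times> A m \<subseteq> square" for m by (auto simp: A_def square_def)
  have close: "dist (p m x) x \<le> 2 / real (Suc m)" for m x
  proof -
    have 1: "\<bar>of_int \<lfloor>real (Suc m) * u\<rfloor> / real (Suc m) - u\<bar> \<le> 1 / real (Suc m)" for u
    proof -
      define k :: real where "k = of_int \<lfloor>real (Suc m) * u\<rfloor>"
      define N :: real where "N = real (Suc m)"
      have "k \<le> N * u" "N * u \<le> k + 1" unfolding k_def N_def by linarith+
      moreover have "0 < N" by (simp add: N_def)
      ultimately have "k / N \<le> u" "u \<le> (k + 1) / N"
        by (simp_all add: pos_divide_le_eq pos_le_divide_eq mult.commute)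
      then have "\<bar>k / N - u\<bar> \<le> 1 / N" by (simp add: add_divide_distrib abs_le_iff)
      then show ?thesis unfolding k_def N_def .
    qed
    have "dist (p m x) x \<le> \<bar>fst (p m x) - fst x\<bar> + \<bar>snd (p m x) - snd x\<bar>"
      using sqrt_sum_squares_le_sum_abs[of "fst (p m x) - fst x" "snd (p m x) - snd x"]
      by (simp add: dist_prod_def dist_real_def)
    also have "\<dots> \<le> 1 / real (Suc m) + 1 / real (Suc m)"
      unfolding p_def fst_conv snd_conv by (intro add_mono 1)
    finally show ?thesis by simp
  qed
  have pg: "p m (g j x) \<in> A m \<times> A m" if "j \<in> {1..n}" "x \<in> space N" for m j x
    by (rule pA[OF gsq[OF that]])
  let ?u = "\<lambda>m x. F (\<lambda>j\<in>{1..n}. p m (g j x))"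
  show "?u m \<in> borel_measurable N" for m
  proof -
    let ?B = "{1..n} \<rightarrow>\<^sub>E (A m \<times> A m)"
    have fin: "finite ?B" by (intro finite_PiE) (auto simp: A_def)
    \<comment> \<open>The rounded tuple is measurable into a finite discrete space, on which every F
      is measurable.\<close>
    have "(\<lambda>x. \<lambda>j\<in>{1..n}. p m (g j x)) \<in> measurable N (count_space ?B)"
      unfolding measurable_count_space_eq2[OF fin]
    proof (intro conjI ballI)
      show "(\<lambda>x. \<lambda>j\<in>{1..n}. p m (g j x)) \<in> space N \<rightarrow> ?B"
        by (intro Pi_I) (simp only: restrict_PiE_iff, blast intro: pg)
      fix b assume b: "b \<in> ?B"
      have "(\<lambda>x. \<lambda>j\<in>{1..n}. p m (g j x)) -` {b} \<inter> space N = {x \<in> space N. \<forall>j\<in>{1..n}. p m (g j x) = b j}"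
      proof -
        have "(\<lambda>j\<in>{1..n}. h j) = b \<longleftrightarrow> (\<forall>j\<in>{1..n}. h j = b j)" for h
          using PiE_arb[OF b] by (auto simp: fun_eq_iff restrict_def)
        then show ?thesis by (simp add: vimage_def Int_def conj_commute)
      qed
      also have "\<dots> \<in> sets N"
      proof (intro sets.sets_Collect_finite_All)
        show "{x \<in> space N. p m (g j x) = b j} \<in> sets N" if "j \<in> {1..n}" for j
        proof -
          have "{x \<in> space N. p m (g j x) = b j} = (\<lambda>x. p m (g j x)) -` {b j} \<inter> space N" by auto
          also have "\<dots> \<in> sets N"
            by (rule measurable_sets[OF measurable_compose[OF g[OF that] p]]) simp
          finally show ?thesis .
        qed
      qed simp
      finally show "(\<lambda>x. \<lambda>j\<in>{1..n}. p m (g j x)) -` {b} \<inter> space N \<in> sets N" .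
    qed
    then show ?thesis by (rule measurable_compose) simp
  qed
  fix x assume x: "x \<in> space N"
  show "(\<lambda>m. ?u m x) \<longlonglongrightarrow> F (\<lambda>j\<in>{1..n}. g j x)"
  proof (rule LIM_zero_cancel, rule Lim_null_comparison)
    have "(\<lambda>m. 2 / real (Suc m)) \<longlonglongrightarrow> 0"
      using LIMSEQ_Suc[OF lim_const_over_n[of "2::real"]] by simp
    then have "(\<lambda>m. (2 / real (Suc m)) powr \<theta>) \<longlonglongrightarrow> 0"
      using \<theta> by (intro tendsto_zero_powrI) auto
    from tendsto_mult_left[OF this, of "K * real n"]
    show "(\<lambda>m. K * real n * (2 / real (Suc m)) powr \<theta>) \<longlonglongrightarrow> 0" by simp
    have "norm (?u m x - F (\<lambda>j\<in>{1..n}. g j x)) \<le> K * real n * (2 / real (Suc m)) powr \<theta>" for m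
    proof -
      have "(\<lambda>j\<in>{1..n}. p m (g j x)) \<in> square_pow n" "(\<lambda>j\<in>{1..n}. g j x) \<in> square_pow n"
        unfolding square_pow_def restrict_PiE_iff using gsq[OF _ x] pg[OF _ x] A_sq by blast+
      from sep_holder_diff[OF F this]
      have "\<bar>?u m x - F (\<lambda>j\<in>{1..n}. g j x)\<bar> \<le> K * (\<Sum>i=1..n. dist (p m (g i x)) (g i x) powr \<theta>)" by simp
      also have "(\<Sum>i=1..n. dist (p m (g i x)) (g i x) powr \<theta>) \<le> (\<Sum>i=1..n. (2 / real (Suc m)) powr \<theta>)"
        using close \<theta> by (intro sum_mono powr_mono2) auto
      finally show ?thesis using K by (simp add: mult_left_mono mult.assoc)
    qed
    then show "\<forall>\<^sub>F m in sequentially. norm (?u m x - F (\<lambda>j\<in>{1..n}. g j x)) \<le> K * real n * (2 / real (Suc m)) powr \<theta>"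
      by simp
  qed
qed

lemma dist_square_le:
  assumes "x \<in> square" "y \<in> square"
  shows "dist x y \<le> 2"
proof -
  have "dist x y \<le> \<bar>fst x - fst y\<bar> + \<bar>snd x - snd y\<bar>"
    using sqrt_sum_squares_le_sum_abs[of "fst x - fst y" "snd x - snd y"]
    by (simp add: dist_prod_def dist_real_def)
  then show ?thesis using assms by (auto simp: square_def)
qed

text \<open>On a set of diameter at most 2 this turns a Lipschitz bound into a \<theta>-Hoelder
  bound, so the density is controlled by the same distance as F.\<close>

lemma le_twice_powr:
  fixes d :: real
  assumes "0 \<le> d" "d \<le> 2" "0 < \<theta>" "\<theta> \<le> 1"
  shows "d \<le> 2 * d powr \<theta>"
proof (cases "d \<le> 1")
  case True
  then have "d powr 1 \<le> d powr \<theta>" using assms by (intro powr_mono') auto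
  then show ?thesis using assms by (simp add: powr_ge_zero order_trans)
next
  case False
  then have "1 \<le> d powr \<theta>" using assms by (intro ge_one_powr_ge_zero) auto
  then show ?thesis using assms by simp
qed

lemma lip_seminorm_props:
  assumes "lip_seminorm \<rho> = ereal L"
  shows "0 \<le> L" and "\<And>s t. s \<in> square \<Longrightarrow> t \<in> square \<Longrightarrow> \<bar>\<rho> s - \<rho> t\<bar> \<le> L * dist s t"
proof -
  have *: "\<bar>\<rho> s - \<rho> t\<bar> / dist s t \<le> L" if "s \<in> square" "t \<in> square" "s \<noteq> t" for s t
  proof -
    have "ereal (\<bar>\<rho> s - \<rho> t\<bar> / dist s t) \<le> lip_seminorm \<rho>"
      unfolding lip_seminorm_def by (rule SUP_upper2[of "(s, t)"]) (use that in auto)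
    then show ?thesis using assms by simp
  qed
  have "0 \<le> \<bar>\<rho> (0, 0) - \<rho> (1, 1)\<bar> / dist (0::real, 0::real) (1, 1)" by simp
  also have "\<dots> \<le> L" by (rule *) (auto simp: square_def)
  finally show "0 \<le> L" .
  fix s t :: "real \<times> real" assume "s \<in> square" "t \<in> square"
  then show "\<bar>\<rho> s - \<rho> t\<bar> \<le> L * dist s t"
    using *[of s t] by (cases "s = t") (auto simp: pos_divide_le_eq)
qed

subsection \<open>Decorrelation for absolutely continuous measures\<close>

lemma square_borel [measurable]: "square \<in> sets borel"
  unfolding square_def borel_prod[symmetric] by simp

lemma space_leb_square [simp]: "space leb_square = square"
  by (simp add: leb_square_def)

lemma measurable_half_open_square: "(\<lambda>x. x) \<in> measurable leb_half_open leb_square"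
  unfolding leb_half_open_def leb_square_def using half_open_square_subset
  by (intro measurable_restrict_space2 measurable_restrict_space1) (auto simp: space_restrict_space)

text \<open>The two squares differ only within the lines \<open>u = 1\<close> and
  \<open>c = 1\<close>, which are null sets.\<close>

lemma integral_leb_square:
  fixes f :: "real \<times> real \<Rightarrow> real"
  assumes f: "f \<in> borel_measurable leb_square"
  shows "integral\<^sup>L leb_square f = integral\<^sup>L leb_half_open f"
proof -
  have "emeasure lborel ({1} \<times> UNIV :: (real \<times> real) set) = 0" "emeasure lborel (UNIV \<times> {1} :: (real \<times> real) set) = 0"
    unfolding lborel_prod[symmetric] by (simp_all add: lborel.emeasure_pair_measure_Times)
  then have "{1} \<times> UNIV \<in> null_sets (lborel :: (real \<times> real) measure)" "UNIV \<times> {1} \<in> null_sets (lborel :: (real \<times> real) measure)"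
    by (auto simp: null_sets_def borel_prod[symmetric])
  then have ae: "AE x in lborel :: (real \<times> real) measure. x \<notin> {1} \<times> UNIV \<and> x \<notin> UNIV \<times> {1}"
    by (intro AE_conjI AE_not_in)
  have "f \<in> borel_measurable leb_half_open"
    by (rule measurable_compose[OF measurable_half_open_square f])
  then have m: "(\<lambda>x. indicat_real half_open_square x *\<^sub>R f x) \<in> borel_measurable lborel"
    "(\<lambda>x. indicat_real square x *\<^sub>R f x) \<in> borel_measurable lborel"
    using f unfolding leb_square_def leb_half_open_def
    by (simp_all add: borel_measurable_restrict_space_iff)
  have "integral\<^sup>L lborel (\<lambda>x. indicat_real square x *\<^sub>R f x) = integral\<^sup>L lborel (\<lambda>x. indicat_real half_open_square x *\<^sub>R f x)"
  proof (rule integral_cong_AE[OF m(2,1) AE_mp[OF ae AE_I2]], rule impI)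
    fix x :: "real \<times> real" assume "x \<notin> {1} \<times> UNIV \<and> x \<notin> UNIV \<times> {1}"
    then have "x \<in> square \<longleftrightarrow> x \<in> half_open_square"
      by (cases x) (auto simp: square_def half_open_square_def less_le)
    then show "indicat_real square x *\<^sub>R f x = indicat_real half_open_square x *\<^sub>R f x"
      by (simp add: indicator_def)
  qed
  then show ?thesis
    unfolding leb_square_def leb_half_open_def by (simp add: integral_restrict_space)
qed


text \<open>The starting index p is free: \<open>p = 1\<close> gives \<open>split_obs\<close>
  itself, while \<open>p = Suc k\<close> treats the second point as the state at time k.\<close>

lemma split_obs_measurable:
  assumes seq: "baker_seq M a" and F: "sep_holder_on \<theta> K n F" and \<theta>: "0 < \<theta>" and K: "0 \<le> K"
    and g: "g \<in> measurable N leb_square" "h \<in> measurable N leb_square"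
    and p: "p \<ge> 1"
  shows "(\<lambda>w. F (\<lambda>j\<in>{1..n}. if j \<le> l then baker_comp M a 1 (idx j) (g w) else baker_comp M a p (idx j) (h w)))
    \<in> borel_measurable N"
proof (rule measurable_sep_holder_compose[OF F \<theta> K])
  fix j
  have "(\<lambda>w. baker_comp M a 1 (idx j) (g w)) \<in> measurable N leb_square"
    "(\<lambda>w. baker_comp M a p (idx j) (h w)) \<in> measurable N leb_square"
    using baker_seq.baker_comp_measurable_square[OF seq] p by (auto intro: measurable_compose g)
  then have m: "(\<lambda>w. if j \<le> l then baker_comp M a 1 (idx j) (g w) else baker_comp M a p (idx j) (h w)) \<in> measurable N leb_square"
    by (cases "j \<le> l") (simp_all only: if_True if_False)
  then show "(\<lambda>w. if j \<le> l then baker_comp M a 1 (idx j) (g w) else baker_comp M a p (idx j) (h w)) \<in> borel_measurable N"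
    unfolding leb_square_def measurable_restrict_space2_iff by simp
  fix w assume "w \<in> space N"
  then show "(if j \<le> l then baker_comp M a 1 (idx j) (g w) else baker_comp M a p (idx j) (h w)) \<in> square"
    using measurable_space[OF m] by simp
qed

context coupled_baker_seq
begin

text \<open>The times \<open>idx 1, ..., idx l\<close> are distinct and at most
  \<open>idx l\<close>, and the times left out contribute nonnegative terms. The full sum has the
  form that \<open>decorrelation\<close> expects, with \<open>N = idx l\<close>.\<close>

lemma orbit_sum_le:
  fixes idx :: "nat \<Rightarrow> nat"
  assumes "strict_mono_on {1..n} idx" "l < n" "x \<in> half_open_square" "y \<in> half_open_square"
  shows "(\<Sum>j=1..l. V (baker_comp M a 1 (idx j) x) (baker_comp M a 1 (idx j) y))
    \<le> (\<Sum>i\<le>idx l. V (baker_comp M a 1 i x) (baker_comp M a 1 i y))"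
proof -
  have "strict_mono_on {1..l} idx" 
  proof (rule strict_mono_onI)
    fix i j assume "i \<in> {1..l}" "j \<in> {1..l}" "i < j"
    then show "idx i < idx j" using assms(2) by (intro strict_mono_onD[OF assms(1)]) auto
  qed
  then have inj: "inj_on idx {1..l}" by (rule strict_mono_on_imp_inj_on)
  have le: "idx j \<le> idx l" if "j \<in> {1..l}" for j
    using strict_mono_on_leD[OF assms(1), of j l] that assms(2) by simp
  have "(\<Sum>j=1..l. V (baker_comp M a 1 (idx j) x) (baker_comp M a 1 (idx j) y))
    = (\<Sum>i\<in>idx ` {1..l}. V (baker_comp M a 1 i x) (baker_comp M a 1 i y))"
    by (subst sum.reindex[OF inj]) (simp add: o_def)
  also have "\<dots> \<le> (\<Sum>i\<le>idx l. V (baker_comp M a 1 i x) (baker_comp M a 1 i y))"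
    using le assms(3,4) by (intro sum_mono2 V_bounds baker_comp_in_half_open_square) auto
  finally show ?thesis .
qed

lemma dist_le_V:
  assumes "x \<in> half_open_square" "y \<in> half_open_square"
  shows "dist x y \<le> 2 * (V x y / min 1 (1 / r - 1))"
proof -
  have "dist x y \<le> 2 * dist x y powr \<theta>"
    using assms half_open_square_subset \<theta> by (intro le_twice_powr dist_square_le) auto
  then show ?thesis using dist_powr_le_V[OF assms] by linarith
qed

text \<open>\<open>decorrelation\<close> is used twice, with z the state at time k. First the state
  of x itself is replaced by an independent Lebesgue point z; then, for fixed x, the state of an
  independent y with density \<rho> is replaced in the same way. Both lead to the same integral, at
  a cost of E each.\<close>

lemma split_obs_decorrelation:
  assumes F: "sep_holder_on \<theta> K n F" "\<And>x. x \<in> square_pow n \<Longrightarrow> \<bar>F x\<bar> \<le> S" and SK: "0 \<le> S" "0 \<le> K"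
    and l: "1 \<le> l" "l < n" and idx: "strict_mono_on {1..n} idx"
    and \<rho>: "\<rho> \<in> borel_measurable leb_half_open" "\<And>x. x \<in> half_open_square \<Longrightarrow> 0 \<le> \<rho> x"
      "\<And>x. x \<in> half_open_square \<Longrightarrow> \<rho> x \<le> R" "integral\<^sup>L leb_half_open \<rho> = 1"
    and L: "0 \<le> L" "\<And>x y. x \<in> half_open_square \<Longrightarrow> y \<in> half_open_square \<Longrightarrow> \<bar>\<rho> x - \<rho> y\<bar> \<le> L * dist x y"
  shows "\<bar>(LINT x|leb_half_open. \<rho> x * split_obs M a n l idx F x x)
      - (LINT x|leb_half_open. \<rho> x * (LINT y|leb_half_open. \<rho> y * split_obs M a n l idx F x y))\<bar>
    \<le> 2 * ((R + 2 * L) / min 1 (1 / r - 1)) / ((1 - lam) * r) * (S + K) * lam ^ (idx (Suc l) - idx l)"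
proof -
  define k where "k = idx (Suc l)"
  define H where "H x z = F (\<lambda>j\<in>{1..n}. if j \<le> l then baker_comp M a 1 (idx j) x else baker_comp M a (Suc k) (idx j) z)" for x z
  define m0 where "m0 = min 1 (1 / r - 1)"
  \<comment> \<open>The numerator dominates \<open>R * K + 2 * L * S\<close>: the oscillation of H
    times the bound on the density, plus the oscillation of the density times the bound on
    H.\<close>
  define A where "A = (R + 2 * L) * (S + K) / m0"
  define E where "E = A * lam / (1 - lam) / r * lam ^ (k - Suc (idx l))"
  have m0: "0 < m0" using r by (simp add: m0_def)
  have k: "idx l < k" unfolding k_def using l by (intro strict_mono_onD[OF idx]) auto
  have seq: "baker_seq M a" ..
  have "(0, 0) \<in> half_open_square" by (simp add: half_open_square_def)
  then have R: "0 \<le> R" using \<rho>(2,3) order_trans by blast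
  have A: "0 \<le> A" using R L SK m0 by (simp add: A_def)
  \<comment> \<open>For \<open>j > l\<close> the time \<open>idx j\<close> is at least k, so these
    components see y only through its state at time k.\<close>
  have split: "split_obs M a n l idx F x y = H x (baker_comp M a 1 k y)" for x y
  proof -
    have "baker_comp M a 1 (idx j) y = baker_comp M a (Suc k) (idx j) (baker_comp M a 1 k y)"
      if "j \<in> {1..n}" "\<not> j \<le> l" for j
      using strict_mono_on_leD[OF idx, of "Suc l" j] that l by (intro baker_comp_split) (auto simp: k_def)
    then show ?thesis unfolding split_obs_def H_def by (intro arg_cong[where f=F]) (auto simp: fun_eq_iff)
  qed
  have arg: "(\<lambda>j\<in>{1..n}. if j \<le> l then baker_comp M a 1 (idx j) x else baker_comp M a (Suc k) (idx j) z) \<in> square_pow n"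
    if "x \<in> half_open_square" "z \<in> half_open_square" for x z
    using that half_open_square_subset unfolding square_pow_def restrict_PiE_iff
    by (auto intro!: baker_comp_in_square)
  have HS: "\<bar>H x z\<bar> \<le> S" if "x \<in> half_open_square" "z \<in> half_open_square" for x z
    unfolding H_def by (intro F arg that)
  have Hm: "(\<lambda>w. H (g w) (h w)) \<in> borel_measurable N"
    if "g \<in> measurable N leb_half_open" "h \<in> measurable N leb_half_open" for g h and N :: "'b measure"
    unfolding H_def using that
    by (intro split_obs_measurable[OF seq F(1) \<theta>(1) SK(2)] measurable_compose[OF _ measurable_half_open_square]) auto
  have [measurable]: "\<rho> \<in> borel_measurable leb_half_open" by (rule \<rho>(1))
  have T[measurable]: "baker_comp M a 1 k \<in> measurable leb_half_open leb_half_open"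
    by (rule baker_comp_measurable_half_open) simp
  have Tin: "baker_comp M a 1 k x \<in> half_open_square" if "x \<in> half_open_square" for x
    using that by (intro baker_comp_in_half_open_square) auto
  have \<rho>H: "\<bar>\<rho> x * H y z\<bar> \<le> R * S" if "x \<in> half_open_square" "y \<in> half_open_square" "z \<in> half_open_square" for x y z
    unfolding abs_mult using \<rho>(2,3)[OF that(1)] HS[OF that(2,3)] R by (intro mult_mono) auto
  have \<rho>osc: "\<bar>\<rho> x - \<rho> y\<bar> * S \<le> 2 * L * S / m0 * V x y" if "x \<in> half_open_square" "y \<in> half_open_square" for x y
  proof -
    have "\<bar>\<rho> x - \<rho> y\<bar> \<le> L * (2 * (V x y / m0))"
      using L(2)[OF that] mult_left_mono[OF dist_le_V[OF that] L(1)] by (simp add: m0_def)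
    from mult_right_mono[OF this SK(1)] show ?thesis by (simp add: algebra_simps)
  qed
  have Hosc: "\<bar>H x z - H y z\<bar> \<le> K / m0 * (\<Sum>j\<le>idx l. V (baker_comp M a 1 j x) (baker_comp M a 1 j y))"
    if xyz: "x \<in> half_open_square" "y \<in> half_open_square" "z \<in> half_open_square" for x y z
  proof -
    have "\<bar>H x z - H y z\<bar> \<le> K * (\<Sum>j=1..n. if j \<le> l then dist (baker_comp M a 1 (idx j) x) (baker_comp M a 1 (idx j) y) powr \<theta> else 0)"
      unfolding H_def
      by (rule order_trans[OF sep_holder_diff[OF F(1) arg[OF xyz(1,3)] arg[OF xyz(2,3)]]])
        (auto intro!: mult_left_mono sum_mono SK)
    also have "(\<Sum>j=1..n. if j \<le> l then dist (baker_comp M a 1 (idx j) x) (baker_comp M a 1 (idx j) y) powr \<theta> else 0)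
        = (\<Sum>j=1..l. dist (baker_comp M a 1 (idx j) x) (baker_comp M a 1 (idx j) y) powr \<theta>)"
      using l by (intro sum.mono_neutral_cong_right) auto
    also have "\<dots> \<le> (\<Sum>j=1..l. V (baker_comp M a 1 (idx j) x) (baker_comp M a 1 (idx j) y) / m0)"
      unfolding m0_def using xyz by (intro sum_mono dist_powr_le_V baker_comp_in_half_open_square) auto
    also have "\<dots> \<le> (\<Sum>j\<le>idx l. V (baker_comp M a 1 j x) (baker_comp M a 1 j y)) / m0"
      using orbit_sum_le[OF idx l(2) xyz(1,2)] m0 by (simp add: divide_right_mono flip: sum_divide_distrib)
    finally show ?thesis using SK by (simp add: mult_left_mono)
  qed
  have V0: "0 \<le> V (baker_comp M a 1 j x) (baker_comp M a 1 j y)"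
    if "x \<in> half_open_square" "y \<in> half_open_square" for j x y
    using that by (intro V_bounds baker_comp_in_half_open_square) auto
  have AL: "2 * L * S / m0 \<le> A"
    unfolding A_def using R L SK m0 by (intro divide_right_mono) (auto simp: algebra_simps)
  have diag: "\<bar>(LINT x|leb_half_open. \<rho> x * H x (baker_comp M a 1 k x)) - (LINT z|leb_half_open. LINT x|leb_half_open. \<rho> x * H x z)\<bar> \<le> E"
  proof -
    let ?f = "\<lambda>(x, z). \<rho> x * H x z"
    have "\<bar>(LINT x|leb_half_open. ?f (x, baker_comp M a 1 k x)) - (LINT z|leb_half_open. LINT x|leb_half_open. ?f (x, z))\<bar> \<le> E"
      unfolding E_def
    proof (rule decorrelation[OF _ _ A _ k, where K = "R * S"])
      show "?f \<in> borel_measurable (leb_half_open \<Otimes>\<^sub>M leb_half_open)"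
        unfolding split_beta by (intro borel_measurable_times Hm) auto
      fix x y z assume xyz: "x \<in> half_open_square" "y \<in> half_open_square" "z \<in> half_open_square"
      let ?s = "\<Sum>j\<le>idx l. V (baker_comp M a 1 j x) (baker_comp M a 1 j y)"
      have "V (baker_comp M a 1 0 x) (baker_comp M a 1 0 y) \<le> ?s"
        using V0 xyz by (intro member_le_sum) auto
      then have Vs: "V x y \<le> ?s" using baker_comp_empty[of M a 0] by simp
      have "\<rho> x * H x z - \<rho> y * H y z = \<rho> x * (H x z - H y z) + (\<rho> x - \<rho> y) * H y z"
        by (simp add: algebra_simps)
      then have "\<bar>\<rho> x * H x z - \<rho> y * H y z\<bar> \<le> \<bar>\<rho> x\<bar> * \<bar>H x z - H y z\<bar> + \<bar>\<rho> x - \<rho> y\<bar> * \<bar>H y z\<bar>"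
        using abs_triangle_ineq by (simp flip: abs_mult)
      also have "\<dots> \<le> R * (K / m0 * ?s) + \<bar>\<rho> x - \<rho> y\<bar> * S"
        using \<rho>(2,3)[OF xyz(1)] Hosc[OF xyz] HS[OF xyz(2,3)] R by (intro add_mono mult_mono) auto
      also have "\<dots> \<le> R * (K / m0 * ?s) + 2 * L * S / m0 * ?s"
        using \<rho>osc[OF xyz(1,2)] mult_left_mono[OF Vs, of "2 * L * S / m0"] L SK m0 by simp
      also have "\<dots> = (R * K + 2 * L * S) / m0 * ?s" by (simp add: add_divide_distrib algebra_simps)
      also have "\<dots> \<le> A * ?s"
        unfolding A_def using R L SK m0 V0 xyz
        by (intro mult_right_mono divide_right_mono sum_nonneg) (auto simp: algebra_simps)
      finally show "\<bar>?f (x, z) - ?f (y, z)\<bar> \<le> A * ?s" by simp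
    next
      fix x z assume "x \<in> half_open_square" "z \<in> half_open_square"
      then show "\<bar>?f (x, z)\<bar> \<le> R * S" using \<rho>H[of x x z] by simp
    qed
    then show ?thesis by simp
  qed
  \<comment> \<open>With x frozen, only the density varies with y, so \<open>N = 0\<close> suffices.
    The resulting exponent \<open>k - 1\<close> is no smaller than the one in E.\<close>
  have inner: "\<bar>(LINT y|leb_half_open. \<rho> y * H x (baker_comp M a 1 k y)) - (LINT z|leb_half_open. H x z)\<bar> \<le> E"
    if x: "x \<in> half_open_square" for x
  proof -
    let ?f = "\<lambda>(y, z). \<rho> y * H x z"
    have "\<bar>(LINT y|leb_half_open. ?f (y, baker_comp M a 1 k y)) - (LINT z|leb_half_open. LINT y|leb_half_open. ?f (y, z))\<bar>
      \<le> A * lam / (1 - lam) / r * lam ^ (k - Suc 0)"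
    proof (rule decorrelation[OF _ _ A, where K = "R * S"])
      show "?f \<in> borel_measurable (leb_half_open \<Otimes>\<^sub>M leb_half_open)"
        unfolding split_beta using x by (intro borel_measurable_times Hm) auto
      fix y y' z assume xyz: "y \<in> half_open_square" "y' \<in> half_open_square" "z \<in> half_open_square"
      have "\<bar>\<rho> y * H x z - \<rho> y' * H x z\<bar> = \<bar>\<rho> y - \<rho> y'\<bar> * \<bar>H x z\<bar>"
        by (simp flip: abs_mult add: algebra_simps)
      also have "\<dots> \<le> \<bar>\<rho> y - \<rho> y'\<bar> * S" using HS[OF x xyz(3)] by (intro mult_left_mono) auto
      also have "\<dots> \<le> 2 * L * S / m0 * V y y'" by (rule \<rho>osc[OF xyz(1,2)])
      also have "\<dots> \<le> A * V y y'" using AL V_bounds[OF xyz(1,2)] by (intro mult_right_mono) auto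
      finally show "\<bar>?f (y, z) - ?f (y', z)\<bar> \<le> A * (\<Sum>j\<le>0. V (baker_comp M a 1 j y) (baker_comp M a 1 j y'))"
        using baker_comp_empty[of M a 0] by simp
    next
      fix y z assume "y \<in> half_open_square" "z \<in> half_open_square"
      then show "\<bar>?f (y, z)\<bar> \<le> R * S" using \<rho>H[of y x z] x by simp
    qed (use k in simp)
    also have "\<dots> \<le> E"
      unfolding E_def using A lam lam_nonneg r k
      by (intro mult_left_mono power_decreasing) auto
    \<comment> \<open>Since \<rho> has integral 1, integrating \<open>\<rho> y * H x z\<close> over
      y leaves \<open>H x z\<close>.\<close>
    finally show ?thesis by (simp add: \<rho>(4))
  qed
  have swap: "(LINT z|leb_half_open. LINT x|leb_half_open. \<rho> x * H x z) = (LINT x|leb_half_open. \<rho> x * (LINT z|leb_half_open. H x z))"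
  proof -
    interpret pair_prob_space leb_half_open leb_half_open ..
    have "(\<lambda>(x, z). \<rho> x * H x z) \<in> borel_measurable (leb_half_open \<Otimes>\<^sub>M leb_half_open)"
      unfolding split_beta by (intro borel_measurable_times Hm) auto
    then have "integrable (leb_half_open \<Otimes>\<^sub>M leb_half_open) (\<lambda>(x, z). \<rho> x * H x z)"
      by (rule P.integrable_bounded[where K = "R * S"])
        (use \<rho>H in \<open>simp add: space_pair_measure mem_Times_iff split_beta\<close>)
    from Fubini_integral[OF this] show ?thesis by simp
  qed
  have outer: "\<bar>(LINT x|leb_half_open. \<rho> x * (LINT y|leb_half_open. \<rho> y * H x (baker_comp M a 1 k y)))
      - (LINT x|leb_half_open. \<rho> x * (LINT z|leb_half_open. H x z))\<bar> \<le> E"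
  proof -
    define u where "u x = (LINT y|leb_half_open. \<rho> y * H x (baker_comp M a 1 k y))" for x
    define v where "v x = (LINT z|leb_half_open. H x z)" for x
    have um: "u \<in> borel_measurable leb_half_open" unfolding u_def
      by (intro leb_half_open.borel_measurable_lebesgue_integral)
        (unfold split_beta, intro borel_measurable_times Hm measurable_compose[OF _ T], auto)
    have vm: "v \<in> borel_measurable leb_half_open" unfolding v_def
      by (intro leb_half_open.borel_measurable_lebesgue_integral) (unfold split_beta, intro Hm, auto)
    have uS: "\<bar>u x\<bar> \<le> R * S" if "x \<in> half_open_square" for x
      unfolding u_def using that
      by (intro leb_half_open.integral_bounded borel_measurable_times Hm T \<rho>(1) measurable_const \<rho>H Tin) simp_all
    have vS: "\<bar>v x\<bar> \<le> S" if "x \<in> half_open_square" for x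
      unfolding v_def using that by (intro leb_half_open.integral_bounded Hm HS) simp_all
    have i1: "integrable leb_half_open (\<lambda>x. \<rho> x * u x)" "integrable leb_half_open (\<lambda>x. \<rho> x * v x)"
    proof -
      show "integrable leb_half_open (\<lambda>x. \<rho> x * u x)"
        using um \<rho>(2,3) R uS unfolding space_leb_half_open[symmetric]
        by (intro leb_half_open.integrable_bounded[where K = "R * (R * S)"])
          (simp_all add: abs_mult mult_mono)
      show "integrable leb_half_open (\<lambda>x. \<rho> x * v x)"
        using vm \<rho>(2,3) R vS unfolding space_leb_half_open[symmetric]
        by (intro leb_half_open.integrable_bounded[where K = "R * S"])
          (simp_all add: abs_mult mult_mono)
    qed
    have i0: "integrable leb_half_open \<rho>"
      using \<rho>(2,3) by (intro leb_half_open.integrable_bounded[where K = R]) auto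
    have "\<bar>LINT x|leb_half_open. \<rho> x * u x - \<rho> x * v x\<bar> \<le> (LINT x|leb_half_open. \<bar>\<rho> x * u x - \<rho> x * v x\<bar>)"
      by (rule integral_abs_bound)
    also have "\<dots> \<le> (LINT x|leb_half_open. \<rho> x * E)"
    proof (intro integral_mono integrable_abs Bochner_Integration.integrable_diff i1 integrable_mult_left i0)
      fix x assume "x \<in> space leb_half_open"
      then have x: "x \<in> half_open_square" by simp
      have "\<bar>\<rho> x * u x - \<rho> x * v x\<bar> = \<rho> x * \<bar>u x - v x\<bar>"
        using \<rho>(2)[OF x] by (simp add: abs_mult flip: right_diff_distrib)
      then show "\<bar>\<rho> x * u x - \<rho> x * v x\<bar> \<le> \<rho> x * E"
        using inner[OF x] \<rho>(2)[OF x] by (simp add: u_def v_def mult_left_mono)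
    qed
    also have "\<dots> = E" using i0 \<rho>(4) by simp
    finally show ?thesis using i1 by (simp add: u_def v_def)
  qed
  have "\<bar>(LINT x|leb_half_open. \<rho> x * split_obs M a n l idx F x x)
      - (LINT x|leb_half_open. \<rho> x * (LINT y|leb_half_open. \<rho> y * split_obs M a n l idx F x y))\<bar> \<le> 2 * E"
    using diag outer unfolding split swap by linarith
  \<comment> \<open>The factor \<open>lam\<close> in E makes up for the step missing in the exponent
    \<open>k - Suc (idx l)\<close>.\<close>
  also have "2 * E = 2 * ((R + 2 * L) / m0) / ((1 - lam) * r) * (S + K) * lam ^ (k - idx l)"
  proof -
    define c where "c = R + 2 * L"
    have "lam ^ (k - idx l) = lam * lam ^ (k - Suc (idx l))"
      using k by (simp flip: power_Suc add: Suc_diff_Suc)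
    then show ?thesis unfolding E_def A_def c_def[symmetric] by (simp add: mult_ac)
  qed
  finally show ?thesis by (simp add: m0_def k_def)
qed

end

section \<open>Passage to the measure with density \<rho>\<close>

lemma integral_density_leb_square:
  assumes \<mu>: "\<mu> = density leb_square (\<lambda>x. ennreal (\<rho> x))"
    and \<rho>: "\<rho> \<in> borel_measurable leb_square" "\<And>x. x \<in> square \<Longrightarrow> 0 \<le> \<rho> x"
    and f: "f \<in> borel_measurable leb_square"
  shows "(LINT x|\<mu>. f x) = (LINT x|leb_half_open. \<rho> x * f x)"
proof -
  have "(LINT x|\<mu>. f x) = (LINT x|leb_square. \<rho> x * f x)"
    unfolding \<mu> using \<rho> f by (subst integral_density) auto
  also have "\<dots> = (LINT x|leb_half_open. \<rho> x * f x)"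
    using \<rho> f by (intro integral_leb_square) auto
  finally show ?thesis .
qed

text \<open>The density has mean 1 and oscillation at most \<open>2 * L\<close>, hence is at most
  \<open>1 + 2 * L\<close>, which serves as R. Then \<open>R + 2 * L\<close> is the
  \<open>1 + 4 * L\<close> of the constant.\<close>

lemma (in coupled_baker_seq) density_decorrelation:
  assumes F: "separately_holder \<theta> n F" and l: "1 \<le> l" "l < n" and idx: "strict_mono_on {1..n} idx"
    and prob: "prob_space \<mu>" and \<mu>: "\<mu> = density leb_square (\<lambda>x. ennreal (\<rho> x))"
    and lip: "lip_seminorm \<rho> = ereal L" and pos: "(INF x\<in>square. \<rho> x) = rho_low" "rho_low > 0"
    and C: "2 * ((1 + 4 * L) / min 1 (1 / r - 1)) / ((1 - lam) * r) \<le> C" "0 < C"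
  shows "ereal \<bar>(LINT x|\<mu>. split_obs M a n l idx F x x)
       - (LINT p|(\<mu> \<Otimes>\<^sub>M \<mu>). split_obs M a n l idx F (fst p) (snd p))\<bar>
    \<le> ereal C * holder_norm \<theta> n F * ereal (lam ^ (idx (Suc l) - idx l))"
proof -
  have n: "n \<ge> 1" using l by simp
  \<comment> \<open>Strict positivity keeps the right-hand side infinite for an infinite norm, since
    0 times infinity is 0 in the extended reals.\<close>
  have lam0: "0 < lam"
  proof -
    have "a_low \<le> a_up" using a_bounds[of 1] by simp
    then have "real M * a_low \<le> real M * a_up" by (simp add: mult_left_mono)
    also have "\<dots> < 1" using a_up M by (simp add: field_simps)
    finally show ?thesis by (simp add: less_le_trans[OF _ lam(2)])
  qed
  consider "holder_norm \<theta> n F = \<infinity>" | S K where "0 \<le> S" "0 \<le> K" "holder_norm \<theta> n F = ereal (S + K)"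
      "\<And>x. x \<in> square_pow n \<Longrightarrow> \<bar>F x\<bar> \<le> S" "sep_holder_on \<theta> K n F"
    using holder_norm_cases[OF F n] by metis
  then show ?thesis
  proof cases
    case 1
    then show ?thesis using C(2) lam0 by simp
  next
    case (2 S K)
    interpret \<mu>: prob_space \<mu> by (rule prob)
    interpret pair_prob_space \<mu> \<mu> ..
    note L = lip_seminorm_props[OF lip]
    have sets[measurable_cong]: "sets \<mu> = sets leb_square" by (simp add: \<mu>)
    have sp: "space \<mu> = square" by (simp add: \<mu>)
    have "L-lipschitz_on square \<rho>"
      using L by (intro lipschitz_onI) (auto simp: dist_real_def)
    then have "\<rho> \<in> borel_measurable (restrict_space borel square)"
      by (intro borel_measurable_continuous_on_restrict lipschitz_on_continuous_on)
    then have \<rho>m[measurable]: "\<rho> \<in> borel_measurable leb_square"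
      unfolding leb_square_def by (subst measurable_cong_sets[OF sets_restrict_space_cong[OF sets_lborel] refl])
    have \<rho>mh: "\<rho> \<in> borel_measurable leb_half_open"
      by (rule measurable_compose[OF measurable_half_open_square \<rho>m])
    have diff: "\<bar>\<rho> x - \<rho> y\<bar> \<le> 2 * L" if "x \<in> square" "y \<in> square" for x y
      using L(2)[OF that] mult_left_mono[OF dist_square_le[OF that] L(1)] by linarith
    have sq0: "(0, 0) \<in> square" by (simp add: square_def)
    have \<rho>0: "0 \<le> \<rho> x" if x: "x \<in> square" for x
    proof -
      \<comment> \<open>A real infimum is a lower bound only for a set bounded below; the Lipschitz
        estimate provides this.\<close>
      have "\<rho> (0, 0) - 2 * L \<le> \<rho> y" if "y \<in> square" for y
        using diff[OF sq0 that] by linarith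
      then have "bdd_below (\<rho> ` square)" by (rule bdd_belowI2)
      then have "rho_low \<le> \<rho> x" unfolding pos(1)[symmetric] using x by (rule cINF_lower)
      then show ?thesis using pos(2) by linarith
    qed
    note int\<mu> = integral_density_leb_square[OF \<mu> \<rho>m \<rho>0]
    have \<rho>1: "integral\<^sup>L leb_half_open \<rho> = 1"
      using int\<mu>[of "\<lambda>_. 1"] \<mu>.prob_space by simp
    have i\<rho>: "integrable leb_half_open \<rho>"
    proof (rule leb_half_open.integrable_bounded[OF \<rho>mh])
      fix x assume "x \<in> space leb_half_open"
      then have "x \<in> square" using half_open_square_subset by auto
      then show "\<bar>\<rho> x\<bar> \<le> \<bar>\<rho> (0, 0)\<bar> + 2 * L" using diff[OF _ sq0, of x] by linarith
    qed
    have \<rho>R: "\<rho> x \<le> 1 + 2 * L" if x: "x \<in> square" for x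
    proof -
      have "(LINT y|leb_half_open. \<rho> x - 2 * L) \<le> integral\<^sup>L leb_half_open \<rho>"
      proof (rule integral_mono[OF _ i\<rho>])
        fix y assume "y \<in> space leb_half_open"
        then have "y \<in> square" using half_open_square_subset by auto
        then show "\<rho> x - 2 * L \<le> \<rho> y" using diff[OF x, of y] by linarith
      qed simp
      then show ?thesis using leb_half_open.prob_space by (simp add: \<rho>1)
    qed
    have sm: "(\<lambda>w. split_obs M a n l idx F (g w) (h w)) \<in> borel_measurable N"
      if "g \<in> measurable N leb_square" "h \<in> measurable N leb_square" for g h and N :: "'b measure"
    proof -
      have seq: "baker_seq M a" ..
      have "split_obs M a n l idx F (g w) (h w) =
        F (\<lambda>j\<in>{1..n}. if j \<le> l then baker_comp M a 1 (idx j) (g w) else baker_comp M a 1 (idx j) (h w))" for w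
        unfolding split_obs_def by (intro arg_cong[where f = F] restrict_ext) auto
      then show ?thesis
        using split_obs_measurable[OF seq 2(5) \<theta>(1) 2(2) that, of 1] by simp
    qed
    have so_bound: "\<bar>split_obs M a n l idx F x y\<bar> \<le> S" if "x \<in> square" "y \<in> square" for x y
      unfolding split_obs_def using that
      by (intro 2(4)) (auto simp: square_pow_def intro!: baker_comp_in_square)
    have "(\<lambda>p. split_obs M a n l idx F (fst p) (snd p)) \<in> borel_measurable (\<mu> \<Otimes>\<^sub>M \<mu>)"
      by (rule sm) measurable
    then have "integrable (\<mu> \<Otimes>\<^sub>M \<mu>) (\<lambda>p. split_obs M a n l idx F (fst p) (snd p))"
      by (rule P.integrable_bounded[where K = S])
        (use so_bound in \<open>simp add: space_pair_measure sp mem_Times_iff\<close>)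
    from integral_fst'[OF this]
    have "(LINT p|(\<mu> \<Otimes>\<^sub>M \<mu>). split_obs M a n l idx F (fst p) (snd p))
      = (LINT x|\<mu>. LINT y|\<mu>. split_obs M a n l idx F x y)" by simp
    also have "\<dots> = (LINT x|\<mu>. LINT y|leb_half_open. \<rho> y * split_obs M a n l idx F x y)"
      by (intro Bochner_Integration.integral_cong refl int\<mu> sm) (auto simp: sp)
    also have "\<dots> = (LINT x|leb_half_open. \<rho> x * (LINT y|leb_half_open. \<rho> y * split_obs M a n l idx F x y))"
    proof (intro int\<mu> leb_half_open.borel_measurable_lebesgue_integral)
      show "(\<lambda>(x, y). \<rho> y * split_obs M a n l idx F x y) \<in> borel_measurable (leb_square \<Otimes>\<^sub>M leb_half_open)"
        unfolding split_beta
        by (intro borel_measurable_times sm measurable_compose[OF _ \<rho>mh] measurable_fst measurable_snd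
          measurable_compose[OF measurable_snd measurable_half_open_square])
    qed
    finally have prod: "(LINT p|(\<mu> \<Otimes>\<^sub>M \<mu>). split_obs M a n l idx F (fst p) (snd p))
      = (LINT x|leb_half_open. \<rho> x * (LINT y|leb_half_open. \<rho> y * split_obs M a n l idx F x y))" .
    have diag: "(LINT x|\<mu>. split_obs M a n l idx F x x) = (LINT x|leb_half_open. \<rho> x * split_obs M a n l idx F x x)"
      by (intro int\<mu> sm) auto
    let ?D = "\<bar>(LINT x|\<mu>. split_obs M a n l idx F x x)
       - (LINT p|(\<mu> \<Otimes>\<^sub>M \<mu>). split_obs M a n l idx F (fst p) (snd p))\<bar>"
    let ?e = "lam ^ (idx (Suc l) - idx l)"
    have "?D \<le> 2 * (((1 + 2 * L) + 2 * L) / min 1 (1 / r - 1)) / ((1 - lam) * r) * (S + K) * ?e"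
      unfolding prod diag
    proof (rule split_obs_decorrelation[OF 2(5,4,1,2) l idx \<rho>mh _ _ \<rho>1 L(1)])
      fix x assume "x \<in> half_open_square"
      then have x: "x \<in> square" using half_open_square_subset by blast
      show "0 \<le> \<rho> x" "\<rho> x \<le> 1 + 2 * L" by (rule \<rho>0[OF x], rule \<rho>R[OF x])
      fix y assume "y \<in> half_open_square"
      then have y: "y \<in> square" using half_open_square_subset by blast
      show "\<bar>\<rho> x - \<rho> y\<bar> \<le> L * dist x y" by (rule L(2)[OF x y])
    qed
    also have "(1 + 2 * L) + 2 * L = 1 + 4 * L" by simp
    also have "2 * ((1 + 4 * L) / min 1 (1 / r - 1)) / ((1 - lam) * r) * (S + K) * ?e \<le> C * (S + K) * ?e"
      using C 2(1,2) lam0 by (intro mult_right_mono) auto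
    finally show ?thesis by (simp add: 2(3))
  qed
qed

section \<open>Uniform rates and constants from the parameter bounds\<close>

lemma admissible_bounds:
  assumes "admissible M a" and "k \<ge> 1"
  shows "a_inf a \<le> a k" "a k \<le> a_sup a"
proof -
  have b: "0 < a j" "a j < 1 / (2 * real M)" if "j \<ge> 1" for j
    using assms(1) that by (auto simp: admissible_def)
  have "bdd_below (a ` {1..})" using b(1) by (intro bdd_belowI2[of _ 0]) (auto intro: less_imp_le)
  then show "a_inf a \<le> a k" unfolding a_inf_def using assms(2) by (intro cINF_lower) auto
  have "bdd_above (a ` {1..})" using b(2) by (intro bdd_aboveI2[of _ _ "1 / (2 * real M)"]) (auto intro: less_imp_le)
  then show "a k \<le> a_sup a" unfolding a_sup_def using assms(2) by (intro cSUP_upper) auto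
qed

text \<open>The quadratic \<open>(1 - b) * r^2 - r + b\<close> has the roots 1 and
  \<open>b / (1 - b)\<close>, the latter below 1 because \<open>b < 1 / 2\<close>. Any r strictly
  between them makes the digit part contract on average; r is also taken above
  \<open>(1 / M) powr \<theta>\<close>, which is below 1 as M \<ge> 2.\<close>

lemma coupling_rates_exist:
  assumes M: "M \<ge> 2" and \<theta>: "0 < \<theta>" "\<theta> \<le> 1" and a: "0 < a_low" "a_low \<le> a_up" "a_up < 1 / (2 * real M)"
  obtains r lam where "coupling M \<theta> a_low a_up r lam" "0 < lam" "lam < 1"
proof -
  define b where "b = real M * a_up"
  have b: "0 < b" "b < 1 / 2" using a M by (auto simp: b_def field_simps)
  have "(1 / real M) powr \<theta> < 1" using M \<theta> powr_less_mono2[of \<theta> "1 / real M" 1] by simp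
  moreover have "b / (1 - b) < 1" using b by simp
  ultimately obtain r where r: "max ((1 / real M) powr \<theta>) (b / (1 - b)) < r" "r < 1"
    using dense[of "max ((1 / real M) powr \<theta>) (b / (1 - b))" 1] by auto
  have "0 < b / (1 - b)" using b by simp
  then have r0: "0 < r" using r by linarith
  have "b < (1 - b) * r" using r b by (simp add: pos_divide_less_eq mult.commute)
  then have "0 < (1 - r) * ((1 - b) * r - b)" using r by simp
  then have "b + (1 - b) * r * r < r" by (simp add: algebra_simps)
  then have \<kappa>: "b / r + (1 - b) * r < 1" using r0 by (simp add: field_simps)
  have al: "real M * a_low \<le> b" using a(2) by (simp add: b_def mult_left_mono)
  have al0: "0 < real M * a_low" using a M by simp
  define t where "t = (1 - real M * a_low) powr \<theta>"
  have t: "0 < t" using al b by (simp add: t_def)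
  have "t < 1 powr \<theta>" unfolding t_def using al al0 b \<theta> by (intro powr_less_mono2) auto
  then have t1: "t < 1" by simp
  define lam where "lam = max (b / r + (1 - b) * r) t"
  have "coupling M \<theta> a_low a_up r lam"
    using M \<theta> a r r0 \<kappa> t1 by unfold_locales (auto simp: lam_def b_def t_def)
  moreover have "0 < lam" "lam < 1" using t t1 \<kappa> by (auto simp: lam_def)
  ultimately show ?thesis by (rule that)
qed

theorem theorem1p2:
  fixes M :: nat and \<theta> a_low a_up rho_low L :: real
  assumes "M \<ge> 2" and "0 < \<theta>" and "\<theta> \<le> 1"
  shows "\<exists>C>0. \<exists>C'>0. \<forall>(a :: nat \<Rightarrow> real) (\<mu> :: (real \<times> real) measure) (\<rho> :: real \<times> real \<Rightarrow> real).
    admissible M a \<and> a_inf a = a_low \<and> a_sup a = a_up \<and>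
    prob_space \<mu> \<and> \<mu> = density leb_square (\<lambda>x. ennreal (\<rho> x)) \<and>
    lip_seminorm \<rho> = ereal L \<and> (INF x\<in>square. \<rho> x) = rho_low \<and> rho_low > 0 \<longrightarrow>
    (\<forall>(n :: nat) (F :: (nat \<Rightarrow> real \<times> real) \<Rightarrow> real) (l :: nat) (idx :: nat \<Rightarrow> nat).
      n \<ge> 2 \<and> separately_holder \<theta> n F \<and> 1 \<le> l \<and> l < n \<and> strict_mono_on {1..n} idx \<longrightarrow>
      ereal \<bar>(LINT x|\<mu>. split_obs M a n l idx F x x)
           - (LINT p|(\<mu> \<Otimes>\<^sub>M \<mu>). split_obs M a n l idx F (fst p) (snd p))\<bar>
        \<le> ereal C * holder_norm \<theta> n F
           * ereal ((real (idx l) + 1) * exp (- C' * sqrt (real (idx (l + 1)) - real (idx l)))))"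
proof (cases "0 < a_low \<and> a_low \<le> a_up \<and> a_up < 1 / (2 * real M)")
  \<comment> \<open>No admissible sequence has these extrema, so the claim is vacuous for any
    constants.\<close>
  case False
  then have "\<not> (admissible M a \<and> a_inf a = a_low \<and> a_sup a = a_up)" for a
    by (auto simp: admissible_def)
  then show ?thesis by (intro exI[of _ 1] conjI zero_less_one allI impI) blast+
next
  case True
  \<comment> \<open>The rates depend only on M, \<theta> and the two extrema and are fixed before
    the sequence and the measure, which makes the constants uniform.\<close>
  then obtain r lam where c: "coupling M \<theta> a_low a_up r lam" and lam0: "0 < lam" and lam1: "lam < 1"
    using coupling_rates_exist[OF assms] by metis
  \<comment> \<open>L is still an arbitrary real here; the maximum with 1 keeps C positive.\<close>
  define C where "C = max 1 (2 * ((1 + 4 * L) / min 1 (1 / r - 1)) / ((1 - lam) * r))"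
  have C: "2 * ((1 + 4 * L) / min 1 (1 / r - 1)) / ((1 - lam) * r) \<le> C" "0 < C" by (auto simp: C_def)
  have C': "0 < - ln lam" using lam0 lam1 by simp
  show ?thesis
  proof (rule exI[of _ C], intro conjI C(2), rule exI[of _ "- ln lam"], intro conjI C' allI impI)
    fix a \<mu> \<rho> n F l and idx :: "nat \<Rightarrow> nat"
    assume h: "admissible M a \<and> a_inf a = a_low \<and> a_sup a = a_up \<and>
      prob_space \<mu> \<and> \<mu> = density leb_square (\<lambda>x. ennreal (\<rho> x)) \<and>
      lip_seminorm \<rho> = ereal L \<and> (INF x\<in>square. \<rho> x) = rho_low \<and> rho_low > 0"
      and g: "n \<ge> 2 \<and> separately_holder \<theta> n F \<and> 1 \<le> l \<and> l < n \<and> strict_mono_on {1..n} idx"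
    interpret coupling M \<theta> a_low a_up r lam by (rule c)
    interpret coupled_baker_seq M \<theta> a_low a_up r lam a
      using h admissible_bounds[of M a] by unfold_locales auto
    define d where "d = idx (Suc l) - idx l"
    have "idx l < idx (Suc l)" using g by (intro strict_mono_onD[of "{1..n}" idx]) auto
    then have d: "1 \<le> real d" "real (idx (l + 1)) - real (idx l) = real d" by (auto simp: d_def)
    \<comment> \<open>As d \<ge> 1, \<open>sqrt d \<le> d\<close>; with \<open>ln lam < 0\<close>
      the exponential bound implies the stretched one.\<close>
    have "sqrt (real d) \<le> sqrt (real d ^ 2)"
      using self_le_power[OF d(1), of 2] by (intro real_sqrt_le_mono) simp
    then have "real d * ln lam \<le> sqrt (real d) * ln lam" using C' by (intro mult_right_mono_neg) auto
    then have "exp (real d * ln lam) \<le> exp (- (- ln lam) * sqrt (real d))" by (simp add: mult.commute)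
    also have "exp (real d * ln lam) = lam ^ d" using lam0 by (simp add: exp_of_nat_mult)
    also have "exp (- (- ln lam) * sqrt (real d)) \<le> (real (idx l) + 1) * exp (- (- ln lam) * sqrt (real d))"
      by (simp add: distrib_right)
    finally have e: "ereal (lam ^ d) \<le> ereal ((real (idx l) + 1) * exp (- (- ln lam) * sqrt (real (idx (l + 1)) - real (idx l))))"
      unfolding d(2) by simp
    have hn: "0 \<le> holder_norm \<theta> n F"
      by (rule holder_norm_cases[of \<theta> n F]) (use g in auto)
    have "ereal \<bar>(LINT x|\<mu>. split_obs M a n l idx F x x)
           - (LINT p|(\<mu> \<Otimes>\<^sub>M \<mu>). split_obs M a n l idx F (fst p) (snd p))\<bar>
        \<le> ereal C * holder_norm \<theta> n F * ereal (lam ^ d)"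
      unfolding d_def using h g by (intro density_decorrelation[OF _ _ _ _ _ _ _ _ _ C]) auto
    also have "\<dots> \<le> ereal C * holder_norm \<theta> n F
           * ereal ((real (idx l) + 1) * exp (- (- ln lam) * sqrt (real (idx (l + 1)) - real (idx l))))"
      using C(2) hn by (intro ereal_mult_left_mono e) auto
    finally show "ereal \<bar>(LINT x|\<mu>. split_obs M a n l idx F x x)
           - (LINT p|(\<mu> \<Otimes>\<^sub>M \<mu>). split_obs M a n l idx F (fst p) (snd p))\<bar>
        \<le> ereal C * holder_norm \<theta> n F
           * ereal ((real (idx l) + 1) * exp (- (- ln lam) * sqrt (real (idx (l + 1)) - real (idx l))))" .
  qed
qed

end
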